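(* Let $l\ge 1$ and let $n_1,\dots,n_k$ be positive integers. The probability that $l$ independently and uniformly chosen elements of $W=\mathcal{S}_{n_k}\wr\cdots\wr\mathcal{S}_{n_1}$ generate a subgroup of $W$ which acts transitively on $N_k\times\cdots\times N_1$ is \[\left(1-\frac{1}{n_1^{l-1}}+O\left(\frac{1}{n_1^{l}}\right)\right)\prod_{i=2}^{k}\left(1-\frac{1}{n_i^{(l-1)\prod_{j=1}^{i-1}n_j}}+O\left(\frac{1}{n_i^{(l-1)\left(\prod_{j=1}^{i-1}n_j\right)+1}}\right)\right).\]
   Context: $N_i=\{1,\dots,n_i\}$. The iterated wreath product $W=\mathcal{S}_{n_k}\wr\cdots\wr\mathcal{S}_{n_1}$, in its natural action on $N_k\times\cdots\times N_1$ (tuples written $(i_k,\dots,i_1)$), is the group of all permutations $\pi$ of $N_k\times\cdots\times N_1$ such that for every $m\in\{1,\dots,k\}$ the coordinates $(j_m,\dots,j_1)$ of $\pi(i_k,\dots,i_1)=(j_k,\dots,j_1)$ depend only on $(i_m,\dots,i_1)$; equivalently, the automorphism group of the rooted tree whose root has $n_1$ children, each vertex at depth $1$ has $n_2$ children, and so on down to depth $k$. For two permutation groups $\mathcal{G}$ on $T$ and $\mathcal{H}$ on $S$, $\mathcal{G}\wr\mathcal{H}=\mathcal{G}^{|S|}\rtimes\mathcal{H}$ acts on $S\times T$ by $(\mu,\pi)(s,t)=(\pi(s),\mu_s(t))$, and the iterated product is obtained by iterating this construction. *)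

theory Defs
  imports "HOL-Algebra.Algebra" "HOL-Probability.Probability"
begin

text \<open>
  The tuple \<open>(i\<^sub>k, \<dots>, i\<^sub>1)\<close> is the function \<open>x\<close> with \<open>x m = i\<^sub>m\<close> for \<open>m \<in> {1..k}\<close>
  (and \<open>undefined\<close> outside \<open>{1..k}\<close>).
\<close>

definition tuples :: "nat \<Rightarrow> (nat \<Rightarrow> nat) \<Rightarrow> (nat \<Rightarrow> nat) set" where
  "tuples k n = (\<Pi>\<^sub>E m\<in>{1..k}. {1..n m})"

definition iterated_wreath ::
    "nat \<Rightarrow> (nat \<Rightarrow> nat) \<Rightarrow> ((nat \<Rightarrow> nat) \<Rightarrow> (nat \<Rightarrow> nat)) monoid" where
  "iterated_wreath k n = (BijGroup (tuples k n))\<lparr>carrier :=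
     {\<pi> \<in> carrier (BijGroup (tuples k n)).
        \<forall>m\<in>{1..k}. \<forall>x\<in>tuples k n. \<forall>y\<in>tuples k n.
          (\<forall>j\<in>{1..m}. x j = y j) \<longrightarrow> (\<forall>j\<in>{1..m}. \<pi> x j = \<pi> y j)}\<rparr>"

text \<open>
  The elements of the wreath product already are permutations of the tuples, so the natural action
  is the identity map into \<^const>\<open>BijGroup\<close>.
\<close>

definition generates_transitive ::
    "nat \<Rightarrow> (nat \<Rightarrow> nat) \<Rightarrow> ((nat \<Rightarrow> nat) \<Rightarrow> (nat \<Rightarrow> nat)) set \<Rightarrow> bool" where
  "generates_transitive k n S \<longleftrightarrow>
     transitive_action ((iterated_wreath k n)\<lparr>carrier := generate (iterated_wreath k n) S\<rparr>)
       (tuples k n) (\<lambda>\<pi>. \<pi>)"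

definition prob_transitive :: "nat \<Rightarrow> nat \<Rightarrow> (nat \<Rightarrow> nat) \<Rightarrow> real" where
  "prob_transitive l k n =
     measure_pmf.prob
       (Pi_pmf {..<l} undefined (\<lambda>_. pmf_of_set (carrier (iterated_wreath k n))))
       {g. generates_transitive k n (g ` {..<l})}"

text \<open>
  The following facts confirm that the uniform distribution and the generated subgroup above
  are meaningful: the wreath product is a finite subgroup of the symmetric group on the tuples, and
  transitivity of a generated subgroup has its elementary meaning.
\<close>

lemma finite_tuples: "finite (tuples k n)"
  unfolding tuples_def by (intro finite_PiE) auto

lemma finite_iterated_wreath: "finite (carrier (iterated_wreath k n))"
proof (rule finite_subset)
  show "carrier (iterated_wreath k n) \<subseteq> (\<Pi>\<^sub>E x\<in>tuples k n. tuples k n)"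
    by (auto simp: iterated_wreath_def BijGroup_def Bij_def PiE_def extensional_def bij_betw_def)
  show "finite (\<Pi>\<^sub>E x\<in>tuples k n. tuples k n)"
    by (intro finite_PiE finite_tuples)
qed

lemma subgroup_iterated_wreath:
  "subgroup (carrier (iterated_wreath k n)) (BijGroup (tuples k n))"
proof -
  let ?T = "tuples k n"
  interpret B: group "BijGroup ?T" by (rule group_BijGroup)
  define agree where "agree = (\<lambda>(m::nat) x y. \<forall>j\<in>{1..m}. (x::nat\<Rightarrow>nat) j = y j)"
  have W: "carrier (iterated_wreath k n) = {\<pi> \<in> Bij ?T. \<forall>m\<in>{1..k}. \<forall>x\<in>?T. \<forall>y\<in>?T.
      agree m x y \<longrightarrow> agree m (\<pi> x) (\<pi> y)}"
    by (simp add: iterated_wreath_def BijGroup_def agree_def)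
  show ?thesis
  proof (rule B.subgroupI)
    show "carrier (iterated_wreath k n) \<subseteq> carrier (BijGroup ?T)"
      by (auto simp: W BijGroup_def)
    have "(\<lambda>x\<in>?T. x) \<in> carrier (iterated_wreath k n)"
      by (simp add: W id_Bij)
    then show "carrier (iterated_wreath k n) \<noteq> {}" by blast
  next
    fix a b assume a: "a \<in> carrier (iterated_wreath k n)" and b: "b \<in> carrier (iterated_wreath k n)"
    have "b x \<in> ?T" if "x \<in> ?T" for x
      using b that by (auto simp: W dest: Bij_imp_funcset)
    then show "a \<otimes>\<^bsub>BijGroup ?T\<^esub> b \<in> carrier (iterated_wreath k n)"
      using a b by (auto simp: W BijGroup_def compose_Bij compose_eq)
  next
    fix a assume a: "a \<in> carrier (iterated_wreath k n)"
    then have aB: "a \<in> Bij ?T" and bij: "bij_betw a ?T ?T" by (auto simp: W Bij_def)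
    let ?b = "\<lambda>x\<in>?T. inv_into ?T a x"
    have inv: "inv\<^bsub>BijGroup ?T\<^esub> a = ?b" using aB by (rule inv_BijGroup)
    have "agree m (?b x) (?b y)"
      if m: "m \<in> {1..k}" and x: "x \<in> ?T" and y: "y \<in> ?T" and xy: "agree m x y" for m x y
    proof -
      define r where "r = (\<lambda>x::nat\<Rightarrow>nat. restrict x {1..m})"
      have r: "r u = r v \<longleftrightarrow> agree m u v" for u v
        by (auto simp: r_def agree_def restrict_def fun_eq_iff)
      define f where "f = (\<lambda>p. r (a (inv_into ?T r p)))"
      have f: "f (r u) = r (a u)" if "u \<in> ?T" for u
      proof -
        have "r u \<in> r ` ?T" using that by (rule imageI)
        then have "inv_into ?T r (r u) \<in> ?T" "r (inv_into ?T r (r u)) = r u"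
          by (rule inv_into_into, rule f_inv_into_f)
        then have "agree m (a (inv_into ?T r (r u))) (a u)"
          using a m that unfolding W r by blast
        then show ?thesis unfolding f_def by (simp only: r)
      qed
      have "f ` (r ` ?T) = r ` (a ` ?T)"
        unfolding image_image by (rule image_cong[OF refl f])
      also have "\<dots> = r ` ?T" using bij by (simp add: bij_betw_def)
      finally have "inj_on f (r ` ?T)"
        by (intro eq_card_imp_inj_on) (auto simp: finite_tuples)
      moreover have bx: "?b x \<in> ?T" "?b y \<in> ?T" "a (?b x) = x" "a (?b y) = y"
        using x y bij by (auto simp: bij_betw_def inv_into_into f_inv_into_f)
      moreover have "f (r (?b x)) = f (r (?b y))"
        using xy unfolding f[OF bx(1)] f[OF bx(2)] bx(3,4) r .
      ultimately have "r (?b x) = r (?b y)"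
        by (blast dest: inj_onD)
      then show ?thesis by (simp add: r)
    qed
    then show "inv\<^bsub>BijGroup ?T\<^esub> a \<in> carrier (iterated_wreath k n)"
      using restrict_inv_into_Bij[OF aB] unfolding inv by (simp add: W)
  qed
qed

lemma group_iterated_wreath: "group (iterated_wreath k n)"
proof -
  have "iterated_wreath k n = (BijGroup (tuples k n))\<lparr>carrier := carrier (iterated_wreath k n)\<rparr>"
    by (simp add: iterated_wreath_def)
  then show ?thesis
    using subgroup.subgroup_is_group[OF subgroup_iterated_wreath group_BijGroup] by metis
qed

lemma generates_transitive_iff:
  assumes S: "S \<subseteq> carrier (iterated_wreath k n)"
  shows "generates_transitive k n S \<longleftrightarrow>
    (\<forall>x\<in>tuples k n. \<forall>y\<in>tuples k n. \<exists>\<pi>\<in>generate (iterated_wreath k n) S. \<pi> x = y)"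
proof -
  let ?H = "(iterated_wreath k n)\<lparr>carrier := generate (iterated_wreath k n) S\<rparr>"
  interpret W: group "iterated_wreath k n" by (rule group_iterated_wreath)
  have H: "group ?H"
    using W.generate_is_subgroup[OF S] by (rule W.subgroup_imp_group)
  have "generate (iterated_wreath k n) S \<subseteq> carrier (iterated_wreath k n)"
    by (rule W.generate_incl[OF S])
  also have "\<dots> \<subseteq> carrier (BijGroup (tuples k n))"
    by (auto simp: iterated_wreath_def)
  finally have "group_hom ?H (BijGroup (tuples k n)) (\<lambda>\<pi>. \<pi>)"
    using H group_BijGroup
    by (auto simp: group_hom_def group_hom_axioms_def hom_def iterated_wreath_def)
  then show ?thesis
    by (auto simp: generates_transitive_def transitive_action_def transitive_action_axioms_def
        group_action_def)
qed

end

theory Submission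
  imports Defs
begin

text \<open>
  Choosing \<open>l\<close> random elements of the wreath product with \<open>k + 1\<close> factors amounts to choosing
  \<open>l\<close> random elements \<open>h\<^sub>i\<close> for \<open>k\<close> factors together with independent random labels in
  \<open>\<S>\<^sub>N\<close>, \<open>N = n\<^sub>k\<^sub>+\<^sub>1\<close>, on the edges \<open>y \<rightarrow> h\<^sub>i y\<close> of the Schreier graph on the \<open>M = n\<^sub>1\<cdots>n\<^sub>k\<close> tuples.
  The generated group is transitive iff the \<open>N\<close>-fold cover of this graph given by the labels is
  connected. If the graph itself is connected, a spanning tree can be contracted, and the cover is
  connected iff the labels of the remaining \<open>(l - 1) M + 1\<close> loops, which are again independent and
  uniform, generate a transitive subgroup of \<open>\<S>\<^sub>N\<close>. So the probability is the product over \<open>i\<close> of the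
  probabilities that \<open>d + 1\<close> random permutations of \<open>N = n\<^sub>i\<close> points generate a transitive
  group, where \<open>d = (l - 1) n\<^sub>1\<cdots>n\<^sub>i\<^sub>-\<^sub>1\<close>.

  For \<open>d \<ge> 1\<close> the main obstruction to transitivity is a common fixed point: there is one with
  probability \<open>N\<^sup>-\<^sup>d\<close> up to the error bounded by the Bonferroni inequality, and a union bound shows that
  invariant sets of size between \<open>2\<close> and \<open>N / 2\<close> contribute at most
  \<open>\<Sum> (N choose r)\<^sup>-\<^sup>d = O(N\<^sup>-\<^sup>d\<^sup>-\<^sup>1)\<close>. For \<open>d = 0\<close> only full cycles count,
  and their proportion is at most \<open>1 / N\<close>.
\<close>

section \<open>Connectivity\<close>

text \<open>Connectivity is expressed through invariants instead of paths: a union of components is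
  a predicate that does not change along edges. Edge directions become irrelevant, and connectivity
  transfers along maps by pulling predicates back.\<close>

definition connected_on :: "'a set \<Rightarrow> ('a \<times> 'a) set \<Rightarrow> bool" where
  "connected_on V R \<longleftrightarrow>
     (\<forall>P. (\<forall>(x, y)\<in>R. P x = P y) \<longrightarrow> (\<forall>x\<in>V. \<forall>y\<in>V. P x = (P y :: bool)))"

lemma connected_onI:
  fixes V :: "'a set"
  assumes "\<And>(P :: 'a \<Rightarrow> bool) x y. (\<And>x y. (x, y) \<in> R \<Longrightarrow> P x = P y) \<Longrightarrow> x \<in> V \<Longrightarrow> y \<in> V \<Longrightarrow> P x \<Longrightarrow> P y"
  shows "connected_on V R"
  unfolding connected_on_def
proof (intro allI impI ballI)
  fix P :: "'a \<Rightarrow> bool" and x y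
  assume R: "\<forall>(x, y)\<in>R. P x = P y" and "x \<in> V" "y \<in> V"
  moreover have "\<And>x y. (x, y) \<in> R \<Longrightarrow> P x = P y" using R by blast
  ultimately show "P x = P y" using assms[of P x y] assms[of P y x] by metis
qed

lemma connected_onD:
  fixes P :: "'a \<Rightarrow> bool"
  assumes "connected_on V R" "\<And>x y. (x, y) \<in> R \<Longrightarrow> P x = P y" "x \<in> V" "y \<in> V"
  shows "P x = P y"
  using assms unfolding connected_on_def by blast

text \<open>Invariants correspond on both sides. One on \<open>V'\<close> pulls back along
  \<open>\<phi>\<close>, which collapses the edges of \<open>R0\<close>; one on \<open>V\<close>
  takes equal values at \<open>v\<close> and \<open>\<phi> v\<close>, because by \<open>V0\<close>
  these points are linked through \<open>R0\<close>, and so it descends to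
  \<open>V'\<close>.\<close>

lemma connected_on_contract:
  fixes V :: "'a set"
  assumes \<phi>: "\<phi> ` V = V'" "V' \<subseteq> V"
    and V0: "\<And>(P :: 'a \<Rightarrow> bool) v. (\<And>x y. (x, y) \<in> R0 \<Longrightarrow> P x = P y) \<Longrightarrow> v \<in> V \<Longrightarrow> P (\<phi> v) = P v"
    and R0: "\<And>x y. (x, y) \<in> R0 \<Longrightarrow> \<phi> x = \<phi> y"
    and R: "R \<subseteq> V \<times> V"
  shows "connected_on V (R0 \<union> R) \<longleftrightarrow> connected_on V' (map_prod \<phi> \<phi> ` R)"
proof
  assume c: "connected_on V (R0 \<union> R)"
  show "connected_on V' (map_prod \<phi> \<phi> ` R)"
  proof (rule connected_onI)
    fix P x y
    assume P: "\<And>x y. (x, y) \<in> map_prod \<phi> \<phi> ` R \<Longrightarrow> P x = P y"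
      and xy: "x \<in> V'" "y \<in> V'" and Px: "P x"
    obtain u v where uv: "u \<in> V" "v \<in> V" "x = \<phi> u" "y = \<phi> v" using xy \<phi> by blast
    have "(P \<circ> \<phi>) u = (P \<circ> \<phi>) v"
    proof (rule connected_onD[OF c _ uv(1,2)])
      fix x y assume "(x, y) \<in> R0 \<union> R"
      then show "(P \<circ> \<phi>) x = (P \<circ> \<phi>) y"
      proof
        assume "(x, y) \<in> R"
        then have "(\<phi> x, \<phi> y) \<in> map_prod \<phi> \<phi> ` R" by force
        then show ?thesis using P by simp
      qed (simp add: R0)
    qed
    then show "P y" using Px uv by simp
  qed
next
  assume c: "connected_on V' (map_prod \<phi> \<phi> ` R)"
  show "connected_on V (R0 \<union> R)"
  proof (rule connected_onI)
    fix P x y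
    assume P: "\<And>x y. (x, y) \<in> R0 \<union> R \<Longrightarrow> P x = P y" and xy: "x \<in> V" "y \<in> V" and Px: "P x"
    have P\<phi>: "P (\<phi> v) = P v" if "v \<in> V" for v
      by (rule V0[OF _ that]) (use P in blast)
    have "P (\<phi> x) = P (\<phi> y)"
    proof (rule connected_onD[OF c])
      fix x' y' assume "(x', y') \<in> map_prod \<phi> \<phi> ` R"
      then obtain u v where uv: "(u, v) \<in> R" "x' = \<phi> u" "y' = \<phi> v" by auto
      then have "u \<in> V" "v \<in> V" using R by auto
      then show "P x' = P y'" using uv P\<phi> P by auto
    qed (use xy \<phi> in auto)
    then show "P y" using P\<phi> xy Px by auto
  qed
qed

text \<open>Predicates pull back along \<open>\<phi>\<close> in one direction and along its inverse
  on the image in the other; \<open>R\<close> stays inside \<open>V\<close>, where the inverse is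
  valid.\<close>

lemma connected_on_image:
  assumes inj: "inj_on \<phi> V" and R: "R \<subseteq> V \<times> V"
  shows "connected_on (\<phi> ` V) (map_prod \<phi> \<phi> ` R) \<longleftrightarrow> connected_on V R"
proof
  assume c: "connected_on V R"
  show "connected_on (\<phi> ` V) (map_prod \<phi> \<phi> ` R)"
  proof (rule connected_onI)
    fix P x y
    assume P: "\<And>x y. (x, y) \<in> map_prod \<phi> \<phi> ` R \<Longrightarrow> P x = P y"
      and xy: "x \<in> \<phi> ` V" "y \<in> \<phi> ` V" and Px: "P x"
    obtain u v where uv: "u \<in> V" "v \<in> V" "x = \<phi> u" "y = \<phi> v" using xy by blast
    have "(P \<circ> \<phi>) u = (P \<circ> \<phi>) v"
      by (rule connected_onD[OF c _ uv(1,2)]) (use P in force)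
    then show "P y" using Px uv by simp
  qed
next
  assume c: "connected_on (\<phi> ` V) (map_prod \<phi> \<phi> ` R)"
  show "connected_on V R"
  proof (rule connected_onI)
    fix P x y
    assume P: "\<And>x y. (x, y) \<in> R \<Longrightarrow> P x = P y" and xy: "x \<in> V" "y \<in> V" and Px: "P x"
    have i: "inv_into V \<phi> (\<phi> v) = v" if "v \<in> V" for v using inj that by simp
    have "(P \<circ> inv_into V \<phi>) (\<phi> x) = (P \<circ> inv_into V \<phi>) (\<phi> y)"
    proof (rule connected_onD[OF c])
      fix x' y' assume "(x', y') \<in> map_prod \<phi> \<phi> ` R"
      then obtain u v where uv: "(u, v) \<in> R" "x' = \<phi> u" "y' = \<phi> v" by auto
      then have "u \<in> V" "v \<in> V" using R by auto
      then show "(P \<circ> inv_into V \<phi>) x' = (P \<circ> inv_into V \<phi>) y'" using uv i P by auto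
    qed (use xy in auto)
    then show "P y" using i xy Px by simp
  qed
qed

section \<open>Schreier graphs, labelled covers and the counting of labelings\<close>

definition action_rel :: "'i set \<Rightarrow> 'a set \<Rightarrow> ('i \<Rightarrow> 'a \<Rightarrow> 'a) \<Rightarrow> ('a \<times> 'a) set" where
  "action_rel I A g = (\<lambda>(i, x). (x, g i x)) ` (I \<times> A)"

text \<open>This is the derived graph of a permutation voltage graph. The set \<open>E\<close>
  indexes the edges, so loops and parallel edges may carry different labels, and each edge lifts to
  one edge per point of the fibre \<open>F\<close>.\<close>

definition cover_rel ::
    "'e set \<Rightarrow> ('e \<Rightarrow> 'a) \<Rightarrow> ('e \<Rightarrow> 'a) \<Rightarrow> 'f set \<Rightarrow> ('e \<Rightarrow> 'f \<Rightarrow> 'f) \<Rightarrow> (('a \<times> 'f) \<times> ('a \<times> 'f)) set" where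
  "cover_rel E s t F \<sigma> = (\<lambda>(e, f). ((s e, f), (t e, \<sigma> e f))) ` (E \<times> F)"

abbreviation labelings :: "'e set \<Rightarrow> 'f set \<Rightarrow> ('e \<Rightarrow> 'f \<Rightarrow> 'f) set" where
  "labelings E F \<equiv> (\<Pi>\<^sub>E e\<in>E. {p. p permutes F})"

text \<open>The index set \<open>{..<r}\<close> is only a representative:
  \<open>card_transitive_labelings\<close> passes to any finite index set of the same size.\<close>

definition transitive_count :: "'f set \<Rightarrow> nat \<Rightarrow> nat" where
  "transitive_count F r = card {\<sigma> \<in> labelings {..<r} F. connected_on F (action_rel {..<r} F \<sigma>)}"

lemma card_labelings:
  assumes "finite E" "finite F"
  shows "card (labelings E F) = fact (card F) ^ card E"
  using assms by (simp add: card_PiE card_permutations)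

lemma finite_labelings: "finite E \<Longrightarrow> finite F \<Longrightarrow> finite (labelings E F)"
  by (intro finite_PiE finite_permutations)

lemma card_PiE_reindex:
  assumes \<psi>: "bij_betw \<psi> I J"
    and Q: "\<And>\<sigma>. \<sigma> \<in> (\<Pi>\<^sub>E j\<in>J. B) \<Longrightarrow> Q' (\<lambda>i\<in>I. \<sigma> (\<psi> i)) \<longleftrightarrow> Q \<sigma>"
  shows "card {\<sigma> \<in> (\<Pi>\<^sub>E j\<in>J. B). Q \<sigma>} = card {\<sigma> \<in> (\<Pi>\<^sub>E i\<in>I. B). Q' \<sigma>}"
proof (rule bij_betw_same_card)
  have b: "bij_betw (\<lambda>\<sigma>. \<lambda>i\<in>I. \<sigma> (\<psi> i)) (\<Pi>\<^sub>E j\<in>J. B) (\<Pi>\<^sub>E i\<in>I. B)"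
  proof (rule bij_betw_byWitness[where f' = "\<lambda>\<tau>. \<lambda>j\<in>J. \<tau> (inv_into I \<psi> j)"])
    have i: "\<psi> (inv_into I \<psi> j) = j" "inv_into I \<psi> j \<in> I" if "j \<in> J" for j
      using \<psi> that by (auto simp: bij_betw_def f_inv_into_f inv_into_into)
    have j: "inv_into I \<psi> (\<psi> i) = i" "\<psi> i \<in> J" if "i \<in> I" for i
      using \<psi> that by (auto simp: bij_betw_def)
    show "\<forall>\<sigma>\<in>(\<Pi>\<^sub>E j\<in>J. B). (\<lambda>j\<in>J. (\<lambda>i\<in>I. \<sigma> (\<psi> i)) (inv_into I \<psi> j)) = \<sigma>"
      using i by (auto simp: fun_eq_iff restrict_def PiE_def extensional_def)
    show "\<forall>\<tau>\<in>(\<Pi>\<^sub>E i\<in>I. B). (\<lambda>i\<in>I. (\<lambda>j\<in>J. \<tau> (inv_into I \<psi> j)) (\<psi> i)) = \<tau>"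
      using j by (auto simp: fun_eq_iff restrict_def PiE_def extensional_def)
    show "(\<lambda>\<sigma>. \<lambda>i\<in>I. \<sigma> (\<psi> i)) ` (\<Pi>\<^sub>E j\<in>J. B) \<subseteq> (\<Pi>\<^sub>E i\<in>I. B)"
      using j by (auto simp: PiE_def extensional_def)
    show "(\<lambda>\<tau>. \<lambda>j\<in>J. \<tau> (inv_into I \<psi> j)) ` (\<Pi>\<^sub>E i\<in>I. B) \<subseteq> (\<Pi>\<^sub>E j\<in>J. B)"
      using i by (auto simp: PiE_def extensional_def)
  qed
  show "bij_betw (\<lambda>\<sigma>. \<lambda>i\<in>I. \<sigma> (\<psi> i)) {\<sigma> \<in> (\<Pi>\<^sub>E j\<in>J. B). Q \<sigma>} {\<sigma> \<in> (\<Pi>\<^sub>E i\<in>I. B). Q' \<sigma>}"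
    by (rule bij_betw_Collect[OF b]) (use Q in auto)
qed

text \<open>Uniform independent labels stay so when each one is transformed by its own bijection.
  This absorbs the change of labels caused by contracting an edge.\<close>

lemma card_PiE_twist:
  assumes \<theta>: "\<And>i. i \<in> I \<Longrightarrow> bij_betw (\<theta> i) B B"
    and Q: "\<And>\<sigma>. \<sigma> \<in> (\<Pi>\<^sub>E i\<in>I. B) \<Longrightarrow> Q' (\<lambda>i\<in>I. \<theta> i (\<sigma> i)) \<longleftrightarrow> Q \<sigma>"
  shows "card {\<sigma> \<in> (\<Pi>\<^sub>E i\<in>I. B). Q \<sigma>} = card {\<sigma> \<in> (\<Pi>\<^sub>E i\<in>I. B). Q' \<sigma>}"
proof (rule bij_betw_same_card)
  have b: "bij_betw (\<lambda>\<sigma>. \<lambda>i\<in>I. \<theta> i (\<sigma> i)) (\<Pi>\<^sub>E i\<in>I. B) (\<Pi>\<^sub>E i\<in>I. B)"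
  proof (rule bij_betw_byWitness[where f' = "\<lambda>\<tau>. \<lambda>i\<in>I. inv_into B (\<theta> i) (\<tau> i)"])
    have i: "\<theta> i (inv_into B (\<theta> i) b) = b" "inv_into B (\<theta> i) b \<in> B"
      "inv_into B (\<theta> i) (\<theta> i b) = b" "\<theta> i b \<in> B" if "i \<in> I" "b \<in> B" for i b
      using \<theta>[OF that(1)] that(2) by (auto simp: bij_betw_def f_inv_into_f inv_into_into)
    show "\<forall>\<sigma>\<in>(\<Pi>\<^sub>E i\<in>I. B). (\<lambda>i\<in>I. inv_into B (\<theta> i) ((\<lambda>i\<in>I. \<theta> i (\<sigma> i)) i)) = \<sigma>"
      using i by (auto simp: fun_eq_iff restrict_def PiE_def extensional_def Pi_def)
    show "\<forall>\<tau>\<in>(\<Pi>\<^sub>E i\<in>I. B). (\<lambda>i\<in>I. \<theta> i ((\<lambda>i\<in>I. inv_into B (\<theta> i) (\<tau> i)) i)) = \<tau>"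
      using i by (auto simp: fun_eq_iff restrict_def PiE_def extensional_def Pi_def)
    show "(\<lambda>\<sigma>. \<lambda>i\<in>I. \<theta> i (\<sigma> i)) ` (\<Pi>\<^sub>E i\<in>I. B) \<subseteq> (\<Pi>\<^sub>E i\<in>I. B)"
      using i by (auto simp: PiE_def extensional_def Pi_def)
    show "(\<lambda>\<tau>. \<lambda>i\<in>I. inv_into B (\<theta> i) (\<tau> i)) ` (\<Pi>\<^sub>E i\<in>I. B) \<subseteq> (\<Pi>\<^sub>E i\<in>I. B)"
      using i by (auto simp: PiE_def extensional_def Pi_def)
  qed
  show "bij_betw (\<lambda>\<sigma>. \<lambda>i\<in>I. \<theta> i (\<sigma> i)) {\<sigma> \<in> (\<Pi>\<^sub>E i\<in>I. B). Q \<sigma>} {\<sigma> \<in> (\<Pi>\<^sub>E i\<in>I. B). Q' \<sigma>}"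
    by (rule bij_betw_Collect[OF b]) (use Q in auto)
qed

text \<open>Conditioning on the value at \<open>e0\<close> fixes the label of the edge that is about
  to be contracted.\<close>

lemma card_PiE_insert_Collect:
  assumes "finite E" "e0 \<notin> E" "finite B"
  shows "card {\<sigma> \<in> (\<Pi>\<^sub>E e\<in>insert e0 E. B). Q \<sigma>} =
    (\<Sum>p\<in>B. card {\<sigma> \<in> (\<Pi>\<^sub>E e\<in>E. B). Q (\<sigma>(e0 := p))})"
proof -
  let ?f = "\<lambda>(p, \<sigma>). \<sigma>(e0 := p)"
  let ?S = "SIGMA p:B. {\<sigma> \<in> (\<Pi>\<^sub>E e\<in>E. B). Q (\<sigma>(e0 := p))}"
  have "{\<sigma> \<in> (\<Pi>\<^sub>E e\<in>insert e0 E. B). Q \<sigma>} = ?f ` ?S"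
    unfolding PiE_insert_eq by auto
  moreover have "inj_on ?f ?S"
    by (rule inj_on_subset[OF inj_combinator[OF assms(2)]]) auto
  ultimately have "card {\<sigma> \<in> (\<Pi>\<^sub>E e\<in>insert e0 E. B). Q \<sigma>} = card ?S"
    by (simp add: card_image)
  also have "\<dots> = (\<Sum>p\<in>B. card {\<sigma> \<in> (\<Pi>\<^sub>E e\<in>E. B). Q (\<sigma>(e0 := p))})"
    using assms by (intro card_SigmaI) (auto intro!: finite_PiE)
  finally show ?thesis .
qed

section \<open>Covers of connected graphs\<close>

lemma bij_betw_permutes_compose:
  assumes v: "v permutes F" and w: "w permutes F"
  shows "bij_betw (\<lambda>p. v \<circ> p \<circ> w) {p. p permutes F} {p. p permutes F}"
proof (rule bij_betw_byWitness[where f' = "\<lambda>p. Hilbert_Choice.inv v \<circ> p \<circ> Hilbert_Choice.inv w"])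
  show "\<forall>p\<in>{p. p permutes F}. Hilbert_Choice.inv v \<circ> (v \<circ> p \<circ> w) \<circ> Hilbert_Choice.inv w = p"
    using permutes_inverses[OF v] permutes_inverses[OF w] by (simp add: fun_eq_iff)
  show "\<forall>p\<in>{p. p permutes F}. v \<circ> (Hilbert_Choice.inv v \<circ> p \<circ> Hilbert_Choice.inv w) \<circ> w = p"
    using permutes_inverses[OF v] permutes_inverses[OF w] by (simp add: fun_eq_iff)
qed (use v w in \<open>auto intro!: permutes_compose permutes_inv\<close>)

lemma action_rel_subset:
  assumes "\<And>i x. i \<in> I \<Longrightarrow> x \<in> A \<Longrightarrow> g i x \<in> A"
  shows "action_rel I A g \<subseteq> A \<times> A"
  using assms by (auto simp: action_rel_def)

lemma labelings_in:
  "\<sigma> \<in> labelings E F \<Longrightarrow> e \<in> E \<Longrightarrow> f \<in> F \<Longrightarrow> \<sigma> e f \<in> F"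
  using permutes_in_image[of "\<sigma> e" F f] by (auto simp: PiE_def Pi_def)

lemma card_transitive_labelings:
  assumes "finite I"
  shows "card {\<sigma> \<in> labelings I F. connected_on F (action_rel I F \<sigma>)} = transitive_count F (card I)"
proof -
  obtain \<psi> where \<psi>: "bij_betw \<psi> {..<card I} I"
    using ex_bij_betw_nat_finite[OF assms] by (auto simp: atLeast0LessThan)
  have eq: "action_rel {..<card I} F (\<lambda>i\<in>{..<card I}. \<sigma> (\<psi> i)) = action_rel I F \<sigma>" for \<sigma>
  proof -
    have "action_rel I F \<sigma> = (\<lambda>(i, x). (x, \<sigma> i x)) ` (map_prod \<psi> id ` ({..<card I} \<times> F))"
      using \<psi> by (auto simp: action_rel_def bij_betw_def map_prod_image image_iff)
    also have "\<dots> = action_rel {..<card I} F (\<lambda>i\<in>{..<card I}. \<sigma> (\<psi> i))"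
      unfolding action_rel_def image_image by (rule image_cong) auto
    finally show ?thesis ..
  qed
  show ?thesis unfolding transitive_count_def
    by (rule card_PiE_reindex[OF \<psi>]) (simp add: eq)
qed

text \<open>Once a single vertex is left, all edges are loops and the cover is the Schreier graph of
  the labels on the fibre over \<open>a\<close>.\<close>

lemma cover_connected_single_vertex:
  assumes s: "s ` E \<subseteq> {a}" and t: "t ` E \<subseteq> {a}" and \<sigma>: "\<sigma> \<in> labelings E F"
  shows "connected_on ({a} \<times> F) (cover_rel E s t F \<sigma>) \<longleftrightarrow> connected_on F (action_rel E F \<sigma>)"
proof -
  have "cover_rel E s t F \<sigma> = map_prod (Pair a) (Pair a) ` action_rel E F \<sigma>"
    unfolding cover_rel_def action_rel_def image_image by (rule image_cong) (use s t in \<open>auto simp: image_subset_iff\<close>)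
  moreover have "{a} \<times> F = Pair a ` F" by auto
  moreover have "action_rel E F \<sigma> \<subseteq> F \<times> F"
    using labelings_in[OF \<sigma>] by (rule action_rel_subset)
  ultimately show ?thesis
    using connected_on_image[of "Pair a" F "action_rel E F \<sigma>"] by (simp add: inj_on_def)
qed

lemma connected_contract_edge:
  assumes st: "s ` E \<subseteq> V" "t ` E \<subseteq> V" and ab: "a \<in> V" "b \<in> V" "a \<noteq> b"
  defines "c \<equiv> (\<lambda>x. if x = b then a else x)"
  shows "connected_on V (insert (a, b) ((\<lambda>e. (s e, t e)) ` E)) \<longleftrightarrow>
    connected_on (V - {b}) ((\<lambda>e. (c (s e), c (t e))) ` E)"
proof -
  have "connected_on V ({(a, b)} \<union> (\<lambda>e. (s e, t e)) ` E) \<longleftrightarrow>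
      connected_on (V - {b}) (map_prod c c ` ((\<lambda>e. (s e, t e)) ` E))"
    by (rule connected_on_contract) (use st ab in \<open>auto simp: c_def\<close>)
  then show ?thesis by (simp add: image_image)
qed

text \<open>A change of gauge: \<open>u\<close> moves the fibre over \<open>t e0\<close> by the
  inverse of \<open>p\<close> and fixes all others, so that the lifts of \<open>e0\<close> get the
  trivial label and can be contracted. Every other label is then multiplied by \<open>u\<close> at
  its target and by the inverse of \<open>u\<close> at its source.\<close>

lemma cover_connected_contract_edge:
  fixes s t :: "'e \<Rightarrow> 'a" and \<sigma> :: "'e \<Rightarrow> 'f \<Rightarrow> 'f"
  assumes st: "s ` E \<subseteq> V" "t ` E \<subseteq> V" and e0: "e0 \<notin> E"
    and ab: "s e0 \<in> V" "t e0 \<in> V" "s e0 \<noteq> t e0"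
    and p: "p permutes F" and \<sigma>: "\<sigma> \<in> labelings E F"
  defines "c \<equiv> (\<lambda>x. if x = t e0 then s e0 else x)"
    and "u \<equiv> (\<lambda>x. if x = t e0 then Hilbert_Choice.inv p else id)"
  shows "connected_on (V \<times> F) (cover_rel (insert e0 E) s t F (\<sigma>(e0 := p))) \<longleftrightarrow>
    connected_on ((V - {t e0}) \<times> F)
      (cover_rel E (\<lambda>e. c (s e)) (\<lambda>e. c (t e)) F (\<lambda>e\<in>E. u (t e) \<circ> \<sigma> e \<circ> Hilbert_Choice.inv (u (s e))))"
proof -
  define \<phi> where "\<phi> = (\<lambda>(x, f). (c x, u x f))"
  define R0 where "R0 = (\<lambda>f. ((s e0, f), (t e0, p f))) ` F"
  have pF: "p f \<in> F \<longleftrightarrow> f \<in> F" "Hilbert_Choice.inv p f \<in> F \<longleftrightarrow> f \<in> F" for f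
    using permutes_in_image[OF p] permutes_in_image[OF permutes_inv[OF p]] by auto
  have u: "u x permutes F" for x by (auto simp: u_def permutes_inv[OF p] permutes_id)
  have uF: "u x f \<in> F \<longleftrightarrow> f \<in> F" for x f using permutes_in_image[OF u] .
  have "cover_rel (insert e0 E) s t F (\<sigma>(e0 := p)) = R0 \<union> cover_rel E s t F \<sigma>"
  proof -
    have "cover_rel (insert e0 E) s t F (\<sigma>(e0 := p)) =
      R0 \<union> (\<lambda>(e, f). ((s e, f), (t e, (\<sigma>(e0 := p)) e f))) ` (E \<times> F)"
      unfolding cover_rel_def R0_def by (subst insert_is_Un) (auto simp: image_iff)
    also have "(\<lambda>(e, f). ((s e, f), (t e, (\<sigma>(e0 := p)) e f))) ` (E \<times> F) = cover_rel E s t F \<sigma>"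
      unfolding cover_rel_def using e0 by (intro image_cong) auto
    finally show ?thesis .
  qed
  moreover have "connected_on (V \<times> F) (R0 \<union> cover_rel E s t F \<sigma>) \<longleftrightarrow>
    connected_on ((V - {t e0}) \<times> F) (map_prod \<phi> \<phi> ` cover_rel E s t F \<sigma>)"
  proof (rule connected_on_contract)
    have "\<phi> (x, f) = (x, f)" if "x \<noteq> t e0" for x f using that by (simp add: \<phi>_def c_def u_def)
    then have "(V - {t e0}) \<times> F \<subseteq> \<phi> ` (V \<times> F)" by (force simp: image_iff)
    moreover have "\<phi> ` (V \<times> F) \<subseteq> (V - {t e0}) \<times> F"
      using ab by (auto simp: \<phi>_def c_def uF split: if_splits)
    ultimately show "\<phi> ` (V \<times> F) = (V - {t e0}) \<times> F" by blast
    show "(V - {t e0}) \<times> F \<subseteq> V \<times> F" by auto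
    show "P (\<phi> v) = P v" if P: "\<And>x y. (x, y) \<in> R0 \<Longrightarrow> P x = P y" and v: "v \<in> V \<times> F"
      for P :: "'a \<times> 'f \<Rightarrow> bool" and v
    proof -
      obtain x f where xf: "v = (x, f)" "x \<in> V" "f \<in> F" using v by auto
      \<comment> \<open>The lift of \<open>e0\<close> that ends at \<open>(t e0, f)\<close> starts
        at exactly the point to which \<open>\<phi>\<close> sends \<open>(t e0, f)\<close>.\<close>
      have "((s e0, Hilbert_Choice.inv p f), (t e0, p (Hilbert_Choice.inv p f))) \<in> R0"
        using xf(3) pF by (auto simp: R0_def)
      then have "P (s e0, Hilbert_Choice.inv p f) = P (t e0, f)"
        using P permutes_inverses(1)[OF p] by metis
      then show ?thesis by (simp add: xf \<phi>_def c_def u_def)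
    qed
    show "\<phi> x = \<phi> y" if "(x, y) \<in> R0" for x y
      using that ab(3) permutes_inverses[OF p] by (auto simp: R0_def \<phi>_def c_def u_def)
    show "cover_rel E s t F \<sigma> \<subseteq> (V \<times> F) \<times> (V \<times> F)"
      using st labelings_in[OF \<sigma>] by (auto simp: cover_rel_def)
  qed
  moreover have "map_prod \<phi> \<phi> ` cover_rel E s t F \<sigma> =
    cover_rel E (\<lambda>e. c (s e)) (\<lambda>e. c (t e)) F (\<lambda>e\<in>E. u (t e) \<circ> \<sigma> e \<circ> Hilbert_Choice.inv (u (s e)))"
    (is "?L = ?R")
  proof -
    \<comment> \<open>The lift with index \<open>(e, f)\<close> on the left is the one with index
      \<open>(e, u (s e) f)\<close> on the right, since its source has been moved by
      \<open>u (s e)\<close>.\<close>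
    let ?\<psi> = "\<lambda>(e, f). (e, u (s e) f)"
    have "?\<psi> ` (E \<times> F) = E \<times> F"
    proof
      show "E \<times> F \<subseteq> ?\<psi> ` (E \<times> F)"
      proof clarify
        fix e f assume "e \<in> E" "f \<in> F"
        moreover have "Hilbert_Choice.inv (u (s e)) f \<in> F"
          using \<open>f \<in> F\<close> permutes_in_image[OF permutes_inv[OF u]] by blast
        moreover have "(e, f) = ?\<psi> (e, Hilbert_Choice.inv (u (s e)) f)"
          using permutes_inverses(1)[OF u] by simp
        ultimately show "(e, f) \<in> ?\<psi> ` (E \<times> F)" by blast
      qed
    qed (auto simp: uF)
    then have "?R = (\<lambda>(e, f). ((c (s e), f),
        (c (t e), (\<lambda>e\<in>E. u (t e) \<circ> \<sigma> e \<circ> Hilbert_Choice.inv (u (s e))) e f))) ` ?\<psi> ` (E \<times> F)"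
      unfolding cover_rel_def by simp
    also have "\<dots> = ?L"
      unfolding cover_rel_def image_image
      by (rule image_cong) (auto simp: \<phi>_def permutes_inverses(2)[OF u])
    finally show ?thesis ..
  qed
  ultimately show ?thesis by simp
qed

text \<open>
  By contracting an edge \<open>e\<close> that is not a loop, the fibre over its target is identified with the
  fibre over its source via the label of \<open>e\<close>; the remaining labels are only translated and
  thus stay uniform. In the end one vertex with \<open>|E| - |V| + 1\<close> loops is left.
\<close>

lemma card_connected_covers:
  fixes s t :: "'e \<Rightarrow> 'a" and F :: "'f set"
  assumes "finite V" "V \<noteq> {}" "finite E" "finite F" "s ` E \<subseteq> V" "t ` E \<subseteq> V"
    and "connected_on V ((\<lambda>e. (s e, t e)) ` E)"
  shows "card V \<le> card E + 1 \<and>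
    card {\<sigma> \<in> labelings E F. connected_on (V \<times> F) (cover_rel E s t F \<sigma>)} =
      fact (card F) ^ (card V - 1) * transitive_count F (card E + 1 - card V)"
  using assms
proof (induction "card V" arbitrary: V E s t)
  case 0
  then show ?case by simp
next
  case (Suc m)
  note V = \<open>finite V\<close> and E = \<open>finite E\<close> and F = \<open>finite F\<close>
    and s = \<open>s ` E \<subseteq> V\<close> and t = \<open>t ` E \<subseteq> V\<close>
    and conn = \<open>connected_on V ((\<lambda>e. (s e, t e)) ` E)\<close>
  show ?case
  proof (cases "m = 0")
    case True
    then obtain a where a: "V = {a}" using Suc.hyps(2) by (metis One_nat_def card_1_singletonE)
    have "{\<sigma> \<in> labelings E F. connected_on (V \<times> F) (cover_rel E s t F \<sigma>)} =
      {\<sigma> \<in> labelings E F. connected_on F (action_rel E F \<sigma>)}"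
      using cover_connected_single_vertex[of s E a t] s t a by blast
    then show ?thesis using card_transitive_labelings[OF E] a by simp
  next
    case False
    obtain e0 where e0: "e0 \<in> E" "s e0 \<noteq> t e0"
    proof (rule ccontr)
      assume "\<not> thesis"
      then have loop: "s e = t e" if "e \<in> E" for e using that \<open>\<And>e0. e0 \<in> E \<Longrightarrow> s e0 \<noteq> t e0 \<Longrightarrow> thesis\<close> by blast
      obtain x where x: "x \<in> V" using Suc.prems by blast
      \<comment> \<open>If all edges were loops, equality with \<open>x\<close> would be an
        invariant, and connectivity would leave only one vertex.\<close>
      have "y = x" if "y \<in> V" for y
        using connected_onD[OF conn, of "\<lambda>v. v = x" y x] loop that x by auto
      then have "V = {x}" using x by blast
      then show False using Suc.hyps(2) False by simp
    qed
    define E' where "E' = E - {e0}"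
    have E': "E = insert e0 E'" "e0 \<notin> E'" "finite E'" using e0 E by (auto simp: E'_def)
    have ab: "s e0 \<in> V" "t e0 \<in> V" using e0 s t by auto
    have st': "s ` E' \<subseteq> V" "t ` E' \<subseteq> V" using s t E' by auto
    define c where "c = (\<lambda>x. if x = t e0 then s e0 else x)"
    let ?V = "V - {t e0}" and ?s = "\<lambda>e. c (s e)" and ?t = "\<lambda>e. c (t e)"
    let ?N = "card {\<sigma> \<in> labelings E' F. connected_on (?V \<times> F) (cover_rel E' ?s ?t F \<sigma>)}"
    have "connected_on ?V ((\<lambda>e. (?s e, ?t e)) ` E')"
      using conn connected_contract_edge[OF st' ab e0(2)] unfolding E'(1) c_def by simp
    moreover have "?s ` E' \<subseteq> ?V" "?t ` E' \<subseteq> ?V" using st' ab e0 by (auto simp: c_def)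
    moreover have "card ?V = m" using Suc.hyps(2) ab V by simp
    moreover have "?V \<noteq> {}" using ab e0 by auto
    ultimately have IH: "m \<le> card E' + 1"
      "?N = fact (card F) ^ (m - 1) * transitive_count F (card E' + 1 - m)"
      using Suc.hyps(1)[of ?V E' ?s ?t] V E'(3) F by auto
    have "card {\<sigma> \<in> labelings E' F. connected_on (V \<times> F) (cover_rel E s t F (\<sigma>(e0 := p)))} = ?N"
      if p: "p permutes F" for p
    proof (rule card_PiE_twist)
      define u where "u = (\<lambda>x. if x = t e0 then Hilbert_Choice.inv p else id)"
      have u: "u x permutes F" for x by (auto simp: u_def permutes_inv[OF p] permutes_id)
      show "bij_betw (\<lambda>q. u (t e) \<circ> q \<circ> Hilbert_Choice.inv (u (s e))) {p. p permutes F} {p. p permutes F}" for e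
        by (intro bij_betw_permutes_compose permutes_inv u)
      show "connected_on (?V \<times> F)
          (cover_rel E' ?s ?t F (\<lambda>e\<in>E'. u (t e) \<circ> \<sigma> e \<circ> Hilbert_Choice.inv (u (s e)))) \<longleftrightarrow>
        connected_on (V \<times> F) (cover_rel E s t F (\<sigma>(e0 := p)))"
        if "\<sigma> \<in> labelings E' F" for \<sigma>
        using cover_connected_contract_edge[OF st' E'(2) ab e0(2) p that]
        unfolding E'(1) c_def u_def by simp
    qed
    then have "card {\<sigma> \<in> labelings E F. connected_on (V \<times> F) (cover_rel E s t F \<sigma>)} =
      (\<Sum>p\<in>{p. p permutes F}. ?N)"
      unfolding E'(1) card_PiE_insert_Collect[OF E'(3,2) finite_permutations[OF F]]
      by (intro sum.cong) auto
    also have "\<dots> = fact (card F) * ?N" using F by (simp add: card_permutations)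
    also have "\<dots> = fact (card F) ^ (card V - 1) * transitive_count F (card E + 1 - card V)"
    proof -
      have "card V - 1 = Suc (m - 1)" using Suc.hyps(2) False by linarith
      moreover have "card E + 1 - card V = card E' + 1 - m" using Suc.hyps(2) E' by simp
      ultimately show ?thesis unfolding IH(2) by simp
    qed
    finally show ?thesis using IH(1) Suc.hyps(2) E' by simp
  qed
qed

section \<open>Permutations with invariant sets\<close>

lemma Collect_permutes_fixing:
  "{p. p permutes F \<and> (\<forall>x\<in>S. p x = x)} = {p. p permutes F - S}"
proof -
  have "p permutes F - S" if "p permutes F" "\<forall>x\<in>S. p x = x" for p
    by (rule permutes_superset[OF that(1)]) (use that in blast)
  moreover have "p permutes F" "\<forall>x\<in>S. p x = x" if "p permutes F - S" for p
    using permutes_subset[OF that] permutes_not_in[OF that] by auto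
  ultimately show ?thesis by blast
qed

text \<open>Such a permutation also preserves \<open>F - A\<close> and is determined by its
  restrictions to the two parts.\<close>

lemma card_permutes_setwise_le:
  assumes F: "finite F" and A: "A \<subseteq> F"
  shows "card {p. p permutes F \<and> p ` A = A} \<le> fact (card A) * fact (card F - card A)"
proof -
  let ?f = "\<lambda>p. (restrict_id p A, restrict_id p (F - A))"
  have "?f p \<in> {p. p permutes A} \<times> {p. p permutes F - A}" if p: "p permutes F" "p ` A = A" for p
  proof -
    have "p ` (F - A) = F - A"
      using p A permutes_inj[OF p(1)] permutes_image[OF p(1)] by (simp add: image_set_diff)
    then have "bij_betw p A A" "bij_betw p (F - A) (F - A)"
      using p permutes_inj[OF p(1)] by (auto simp: bij_betw_def intro: inj_on_subset)
    then show ?thesis by (simp add: permutes_restrict_id)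
  qed
  moreover have "inj_on ?f {p. p permutes F \<and> p ` A = A}"
  proof (rule inj_onI)
    fix p q assume p: "p \<in> {p. p permutes F \<and> p ` A = A}" and q: "q \<in> {p. p permutes F \<and> p ` A = A}"
      and eq: "?f p = ?f q"
    show "p = q"
    proof
      fix x
      consider "x \<in> A" | "x \<in> F - A" | "x \<notin> F" using A by blast
      then show "p x = q x"
      proof cases
        case 3
        then show ?thesis using p q permutes_not_in[of p F x] permutes_not_in[of q F x] by simp
      qed (use eq in \<open>auto simp: restrict_id_def fun_eq_iff split: if_splits\<close>)
    qed
  qed
  ultimately have "card {p. p permutes F \<and> p ` A = A} \<le> card ({p. p permutes A} \<times> {p. p permutes F - A})"
    using F A by (intro card_inj_on_le[where f = ?f]) (auto intro!: finite_permutations intro: finite_subset)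
  also have "\<dots> = fact (card A) * fact (card F - card A)"
    using F A by (simp add: card_cartesian_product card_permutations card_Diff_subset finite_subset)
  finally show ?thesis .
qed

text \<open>
  Deleting the point \<open>x\<close> from a full cycle \<open>p\<close>, by composing it with the transposition
  of \<open>x\<close> and \<open>p x\<close>, leaves a full cycle on the remaining points.
\<close>

lemma card_transitive_permutations_le:
  assumes "finite F" "F \<noteq> {}"
  shows "card {p. p permutes F \<and> connected_on F ((\<lambda>x. (x, p x)) ` F)} \<le> fact (card F - 1)"
  using assms
proof (induction F rule: finite_ne_induct)
  case (singleton x)
  have "card {p. p permutes {x} \<and> connected_on {x} ((\<lambda>x. (x, p x)) ` {x})} \<le> card {p. p permutes {x}}"
    by (rule card_mono) (auto intro!: finite_permutations)
  then show ?case by (simp add: card_permutations)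
next
  case (insert x F)
  let ?C = "\<lambda>F. {p. p permutes F \<and> connected_on F ((\<lambda>x. (x, p x)) ` F)}"
  let ?f = "\<lambda>p. (p x, Transposition.transpose x (p x) \<circ> p)"
  have "?f p \<in> F \<times> ?C F" if "p \<in> ?C (insert x F)" for p
  proof -
    have p: "p permutes insert x F" and c: "connected_on (insert x F) ((\<lambda>x. (x, p x)) ` insert x F)"
      using that by auto
    have inj: "p u = p v \<longleftrightarrow> u = v" for u v using permutes_inj[OF p] by (auto dest: injD)
    \<comment> \<open>A fixed point \<open>x\<close> would be a component on its own, although
      \<open>F\<close> contains further points.\<close>
    have ne: "p x \<noteq> x"
    proof
      assume px: "p x = x"
      obtain y where y: "y \<in> F" using insert.hyps by blast
      have "(x = x) = (y = x)"
        by (rule connected_onD[OF c]) (use px inj y in auto)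
      then show False using y insert.hyps by auto
    qed
    have pF: "p y \<in> insert x F" if "y \<in> insert x F" for y
      using permutes_in_image[OF p] that by blast
    let ?p = "Transposition.transpose x (p x) \<circ> p"
    have "connected_on F ((\<lambda>x. (x, ?p x)) ` F)"
    proof (rule connected_onI)
      fix P u v
      assume P: "\<And>a b. (a, b) \<in> (\<lambda>x. (x, ?p x)) ` F \<Longrightarrow> P a = P b"
        and uv: "u \<in> F" "v \<in> F" and Pu: "P u"
      \<comment> \<open>The deleted point takes the value of its successor \<open>p x\<close>. Its
        predecessor then has the same value, because the composed permutation sends it to
        \<open>p x\<close>.\<close>
      define P' where "P' = (\<lambda>y. if y = x then P (p x) else P y)"
      have "P' u = P' v"
      proof (rule connected_onD[OF c])
        fix a b assume "(a, b) \<in> (\<lambda>x. (x, p x)) ` insert x F"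
        then have a: "a \<in> insert x F" and b: "b = p a" by auto
        show "P' a = P' b"
        proof (cases "a = x")
          case True
          then show ?thesis using b ne by (simp add: P'_def)
        next
          case False
          then have "P a = P (?p a)" using P a by blast
          then show ?thesis using False b inj[of a x] ne
            by (cases "p a = x") (auto simp: P'_def)
        qed
      qed (use uv in auto)
      then show "P v" using Pu uv insert.hyps by (auto simp: P'_def split: if_splits)
    qed
    moreover have "?p permutes F" using permutes_insert_lemma[OF p] .
    ultimately show ?thesis using pF[of x] ne by auto
  qed
  moreover have "inj_on ?f (?C (insert x F))"
  proof (rule inj_onI)
    fix p q assume "?f p = ?f q"
    then have "p x = q x" "Transposition.transpose x (p x) \<circ> p = Transposition.transpose x (p x) \<circ> q" by auto
    then have "Transposition.transpose x (p x) \<circ> (Transposition.transpose x (p x) \<circ> p) = Transposition.transpose x (p x) \<circ> (Transposition.transpose x (p x) \<circ> q)"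
      by simp
    then show "p = q" by (simp add: comp_assoc[symmetric])
  qed
  moreover have "finite (?C F)"
    by (rule finite_subset[OF _ finite_permutations[OF insert.hyps(1)]]) auto
  ultimately have "card (?C (insert x F)) \<le> card (F \<times> ?C F)"
    using insert.hyps(1) by (intro card_inj_on_le[where f = ?f]) auto
  also have "\<dots> \<le> card F * fact (card F - 1)"
    using insert.IH by (simp add: card_cartesian_product)
  also have "\<dots> = fact (card (insert x F) - 1)"
    using insert.hyps by (simp add: fact_reduce card_gt_0_iff)
  finally show ?case .
qed

lemma transitive_count_1_le:
  assumes "finite F" "F \<noteq> {}"
  shows "transitive_count F 1 \<le> fact (card F - 1)"
proof -
  let ?C = "{p. p permutes F \<and> connected_on F ((\<lambda>x. (x, p x)) ` F)}"
  have r: "action_rel {..<1} F \<sigma> = (\<lambda>x. (x, \<sigma> 0 x)) ` F" for \<sigma> :: "nat \<Rightarrow> 'a \<Rightarrow> 'a"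
    by (auto simp: action_rel_def image_iff)
  have "transitive_count F 1 \<le> card ?C"
    unfolding transitive_count_def
  proof (rule card_inj_on_le[where f = "\<lambda>\<sigma>. \<sigma> 0"])
    show "inj_on (\<lambda>\<sigma>. \<sigma> 0) {\<sigma> \<in> labelings {..<1::nat} F. connected_on F (action_rel {..<1} F \<sigma>)}"
    proof (rule inj_onI)
      fix \<sigma> \<tau> :: "nat \<Rightarrow> 'a \<Rightarrow> 'a"
      assume "\<sigma> \<in> {\<sigma> \<in> labelings {..<1::nat} F. connected_on F (action_rel {..<1} F \<sigma>)}"
        "\<tau> \<in> {\<sigma> \<in> labelings {..<1::nat} F. connected_on F (action_rel {..<1} F \<sigma>)}"
      then have \<sigma>: "\<sigma> \<in> labelings {..<1::nat} F" and \<tau>: "\<tau> \<in> labelings {..<1::nat} F" by blast+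
      assume "\<sigma> 0 = \<tau> 0"
      then show "\<sigma> = \<tau>" by (auto intro: PiE_ext[OF \<sigma> \<tau>])
    qed
    show "finite ?C"
      by (rule finite_subset[OF _ finite_permutations[OF assms(1)]]) auto
  qed (auto simp: r[simplified] PiE_def Pi_def)
  also have "\<dots> \<le> fact (card F - 1)" by (rule card_transitive_permutations_le[OF assms])
  finally show ?thesis .
qed

section \<open>Upper and lower bounds for the number of intransitive families\<close>

text \<open>By induction: the new set meets the union of the old ones in at most the sum of its
  pairwise intersections. Ordered pairs are summed, so the correction term is twice the sharp one,
  which affects only constants.\<close>

lemma bonferroni_le:
  assumes "finite I" "\<And>i. i \<in> I \<Longrightarrow> finite (A i)"
  shows "(\<Sum>i\<in>I. card (A i)) \<le> card (\<Union>i\<in>I. A i) + (\<Sum>i\<in>I. \<Sum>j\<in>I - {i}. card (A i \<inter> A j))"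
  using assms
proof (induction I rule: finite_induct)
  case (insert x I)
  let ?U = "\<Union>i\<in>I. A i"
  have fin: "finite ?U" "finite (A x)" using insert by auto
  have "card (A x \<inter> ?U) \<le> (\<Sum>j\<in>I. card (A x \<inter> A j))"
    unfolding Int_UN_distrib by (rule card_UN_le[OF insert.hyps(1)])
  moreover have "card (A x) + card ?U = card (A x \<union> ?U) + card (A x \<inter> ?U)"
    by (rule card_Un_Int[OF fin(2,1)])
  moreover have "(\<Sum>i\<in>I. \<Sum>j\<in>I - {i}. card (A i \<inter> A j)) \<le>
      (\<Sum>i\<in>I. \<Sum>j\<in>insert x I - {i}. card (A i \<inter> A j))"
    using insert.hyps(1) by (intro sum_mono sum_mono2) auto
  moreover have "insert x I - {x} = I" using insert.hyps by auto
  moreover have "(\<Sum>i\<in>I. card (A i)) \<le> card ?U + (\<Sum>i\<in>I. \<Sum>j\<in>I - {i}. card (A i \<inter> A j))"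
    using insert by simp
  ultimately show ?case
    unfolding sum.insert[OF insert.hyps(1,2)] UN_insert by simp
qed simp

lemma intransitive_count_eq:
  assumes "finite F"
  shows "card {\<sigma> \<in> labelings {..<r} F. \<not> connected_on F (action_rel {..<r} F \<sigma>)} + transitive_count F r
    = fact (card F) ^ r"
proof -
  have "labelings {..<r} F = {\<sigma> \<in> labelings {..<r} F. \<not> connected_on F (action_rel {..<r} F \<sigma>)} \<union>
    {\<sigma> \<in> labelings {..<r} F. connected_on F (action_rel {..<r} F \<sigma>)}" by blast
  moreover have "card \<dots> = card {\<sigma> \<in> labelings {..<r} F. \<not> connected_on F (action_rel {..<r} F \<sigma>)} +
    card {\<sigma> \<in> labelings {..<r} F. connected_on F (action_rel {..<r} F \<sigma>)}"
    using finite_labelings[OF finite_lessThan assms, of r] by (intro card_Un_disjoint) auto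
  ultimately show ?thesis
    unfolding transitive_count_def using card_labelings[OF finite_lessThan assms, of r] by simp
qed

text \<open>The union bound over all sets \<open>A\<close> of at most half the points that are
  preserved by every member of the family.\<close>

lemma intransitive_count_le:
  assumes F: "finite F"
  shows "card {\<sigma> \<in> labelings {..<r} F. \<not> connected_on F (action_rel {..<r} F \<sigma>)} \<le>
    (\<Sum>k = 1..card F div 2. (card F choose k) * (fact k * fact (card F - k)) ^ r)"
proof -
  define \<Omega> where "\<Omega> A = (\<Pi>\<^sub>E i\<in>{..<r}. {p. p permutes F \<and> p ` A = A})" for A
  have fin\<Omega>: "finite (\<Omega> A)" for A
    unfolding \<Omega>_def
    by (intro finite_PiE finite_subset[OF _ finite_permutations[OF F]]) auto
  have card\<Omega>: "card (\<Omega> A) \<le> (fact (card A) * fact (card F - card A)) ^ r" if "A \<subseteq> F" for A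
    unfolding \<Omega>_def using card_permutes_setwise_le[OF F that] by (simp add: card_PiE power_mono)
  have cover: "\<exists>k\<in>{1..card F div 2}. \<exists>A\<in>{A. A \<subseteq> F \<and> card A = k}. \<sigma> \<in> \<Omega> A"
    if \<sigma>: "\<sigma> \<in> labelings {..<r} F" and nc: "\<not> connected_on F (action_rel {..<r} F \<sigma>)" for \<sigma>
  proof -
    obtain P :: "'a \<Rightarrow> bool" and x y where P: "\<And>i a. i < r \<Longrightarrow> a \<in> F \<Longrightarrow> P (\<sigma> i a) = P a"
      and xy: "x \<in> F" "y \<in> F" "P x" "\<not> P y"
    proof (rule ccontr)
      assume no: "\<not> thesis"
      have "connected_on F (action_rel {..<r} F \<sigma>)"
      proof (rule connected_onI, rule ccontr)
        fix P x y
        assume P: "\<And>a b. (a, b) \<in> action_rel {..<r} F \<sigma> \<Longrightarrow> P a = P b"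
          and xy: "x \<in> F" "y \<in> F" "P x" "\<not> P y"
        have "P (\<sigma> i a) = P a" if "i < r" "a \<in> F" for i a
          by (rule P[symmetric]) (use that in \<open>force simp: action_rel_def\<close>)
        then show False using no that xy by blast
      qed
      then show False using nc by blast
    qed
    have mem: "\<sigma> \<in> \<Omega> {a \<in> F. Q a}" if Q: "\<And>i a. i < r \<Longrightarrow> a \<in> F \<Longrightarrow> Q (\<sigma> i a) = Q a" for Q
    proof -
      have "\<sigma> i ` {a \<in> F. Q a} = {a \<in> F. Q a}" if i: "i < r" for i
      proof (rule endo_inj_surj)
        have p: "\<sigma> i permutes F" using \<sigma> i by auto
        show "\<sigma> i ` {a \<in> F. Q a} \<subseteq> {a \<in> F. Q a}"
          using Q[OF i] permutes_in_image[OF p] by auto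
        show "inj_on (\<sigma> i) {a \<in> F. Q a}" using permutes_inj[OF p] by (rule inj_on_subset) simp
      qed (use F in simp)
      then show ?thesis using \<sigma> by (auto simp: \<Omega>_def PiE_def Pi_def)
    qed
    \<comment> \<open>The invariant set and its complement are both nonempty and both preserved;
      whichever has at most half of the points serves as witness.\<close>
    let ?A = "{a \<in> F. P a}" and ?B = "{a \<in> F. \<not> P a}"
    have fin: "finite ?A" "finite ?B" using F by auto
    have ne: "card ?A \<ge> 1" "card ?B \<ge> 1"
      using xy fin by (auto simp: Suc_le_eq card_gt_0_iff)
    have "card ?A + card ?B = card (?A \<union> ?B)" by (rule card_Un_disjoint[symmetric]) (use fin in auto)
    also have "?A \<union> ?B = F" by auto
    finally consider "card ?A \<le> card F div 2" | "card ?B \<le> card F div 2" by linarith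
    then show ?thesis
    proof cases
      case 1
      moreover have "\<sigma> \<in> \<Omega> ?A" by (rule mem[OF P])
      ultimately show ?thesis using ne by (intro bexI[of _ "card ?A"] bexI[of _ ?A]) auto
    next
      case 2
      moreover have "\<sigma> \<in> \<Omega> ?B" by (rule mem) (simp add: P)
      ultimately show ?thesis using ne by (intro bexI[of _ "card ?B"] bexI[of _ ?B]) auto
    qed
  qed
  have "{\<sigma> \<in> labelings {..<r} F. \<not> connected_on F (action_rel {..<r} F \<sigma>)} \<subseteq>
    (\<Union>k\<in>{1..card F div 2}. \<Union>A\<in>{A. A \<subseteq> F \<and> card A = k}. \<Omega> A)"
  proof
    fix \<sigma> assume "\<sigma> \<in> {\<sigma> \<in> labelings {..<r} F. \<not> connected_on F (action_rel {..<r} F \<sigma>)}"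
    then obtain k A where "k \<in> {1..card F div 2}" "A \<in> {A. A \<subseteq> F \<and> card A = k}" "\<sigma> \<in> \<Omega> A"
      using cover[of \<sigma>] by auto
    then show "\<sigma> \<in> (\<Union>k\<in>{1..card F div 2}. \<Union>A\<in>{A. A \<subseteq> F \<and> card A = k}. \<Omega> A)"
      by (intro UN_I)
  qed
  then have "card {\<sigma> \<in> labelings {..<r} F. \<not> connected_on F (action_rel {..<r} F \<sigma>)} \<le>
    card (\<Union>k\<in>{1..card F div 2}. \<Union>A\<in>{A. A \<subseteq> F \<and> card A = k}. \<Omega> A)"
    by (intro card_mono) (use F fin\<Omega> in auto)
  also have "\<dots> \<le> (\<Sum>k = 1..card F div 2. card (\<Union>A\<in>{A. A \<subseteq> F \<and> card A = k}. \<Omega> A))"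
    by (rule card_UN_le) simp
  also have "\<dots> \<le> (\<Sum>k = 1..card F div 2. \<Sum>A\<in>{A. A \<subseteq> F \<and> card A = k}. card (\<Omega> A))"
    by (intro sum_mono card_UN_le) (use F in simp)
  also have "\<dots> \<le> (\<Sum>k = 1..card F div 2. \<Sum>A\<in>{A. A \<subseteq> F \<and> card A = k}. (fact k * fact (card F - k)) ^ r)"
    by (intro sum_mono) (use card\<Omega> in auto)
  also have "\<dots> = (\<Sum>k = 1..card F div 2. (card F choose k) * (fact k * fact (card F - k)) ^ r)"
    using F by (simp add: n_subsets)
  finally show ?thesis .
qed

text \<open>Families with a common fixed point are intransitive once there are two points. Their
  number is bounded below by Bonferroni, subtracting the families that fix two given points.\<close>

lemma intransitive_count_ge:
  assumes F: "finite F" and two: "card F \<ge> 2"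
  shows "card F * fact (card F - 1) ^ r \<le>
    card {\<sigma> \<in> labelings {..<r} F. \<not> connected_on F (action_rel {..<r} F \<sigma>)} +
    card F * (card F - 1) * fact (card F - 2) ^ r"
proof -
  \<comment> \<open>Fixing \<open>x\<close> is encoded as permuting \<open>F - {x}\<close>, so that
    cardinalities of the sets and of their intersections come from
    \<open>card_labelings\<close>.\<close>
  define \<Omega> where "\<Omega> x = labelings {..<r} (F - {x})" for x
  have fin: "finite (\<Omega> x)" for x unfolding \<Omega>_def using F by (intro finite_labelings) auto
  have inter: "\<Omega> x \<inter> \<Omega> y = labelings {..<r} (F - {x, y})" for x y
  proof -
    have "\<Omega> x \<inter> \<Omega> y = (\<Pi>\<^sub>E i\<in>{..<r}. {p. p permutes F - {x}} \<inter> {p. p permutes F - {y}})"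
      unfolding \<Omega>_def by (rule PiE_Int)
    also have "{p. p permutes F - {x}} \<inter> {p. p permutes F - {y}} = {p. p permutes F - {x, y}}"
      unfolding Collect_permutes_fixing[symmetric] by auto
    finally show ?thesis .
  qed
  have pair: "card (\<Omega> x \<inter> \<Omega> y) = fact (card F - 2) ^ r" if "x \<in> F" "y \<in> F - {x}" for x y
  proof -
    have "card {x, y} = 2" using that by auto
    then show ?thesis using F that inter
      by (simp add: card_labelings card_Diff_subset)
  qed
  have single: "card (\<Omega> x) = fact (card F - 1) ^ r" if "x \<in> F" for x
    unfolding \<Omega>_def using F that by (simp add: card_labelings)
  have "\<Omega> x \<subseteq> {\<sigma> \<in> labelings {..<r} F. \<not> connected_on F (action_rel {..<r} F \<sigma>)}" if x: "x \<in> F" for x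
  proof
    fix \<sigma> assume \<sigma>: "\<sigma> \<in> \<Omega> x"
    then have p: "\<sigma> i permutes F" "\<sigma> i x = x" if "i < r" for i
      using that Collect_permutes_fixing[of F "{x}"] unfolding \<Omega>_def by blast+
    have "F \<noteq> {x}" using two by auto
    then obtain y where y: "y \<in> F" "y \<noteq> x" using x by auto
    have "\<not> connected_on F (action_rel {..<r} F \<sigma>)"
    proof
      assume c: "connected_on F (action_rel {..<r} F \<sigma>)"
      \<comment> \<open>Equality with the common fixed point is an invariant that separates
        \<open>x\<close> from \<open>y\<close>.\<close>
      have "(x = x) = (y = x)"
      proof (rule connected_onD[OF c _ x y(1)])
        fix a b assume "(a, b) \<in> action_rel {..<r} F \<sigma>"
        then obtain i where i: "i < r" "b = \<sigma> i a" by (auto simp: action_rel_def)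
        then show "(a = x) = (b = x)"
          using p(2)[OF i(1)] inj_eq[OF permutes_inj[OF p(1)[OF i(1)]], of a x] by (simp add: i(2))
      qed
      then show False using y by simp
    qed
    moreover have "\<sigma> \<in> labelings {..<r} F" using \<sigma> p by (auto simp: \<Omega>_def PiE_def)
    ultimately show "\<sigma> \<in> {\<sigma> \<in> labelings {..<r} F. \<not> connected_on F (action_rel {..<r} F \<sigma>)}" by blast
  qed
  then have U: "card (\<Union>x\<in>F. \<Omega> x) \<le>
    card {\<sigma> \<in> labelings {..<r} F. \<not> connected_on F (action_rel {..<r} F \<sigma>)}"
    by (intro card_mono) (use finite_labelings[OF finite_lessThan F, of r] in auto)
  have "card F * fact (card F - 1) ^ r = (\<Sum>x\<in>F. card (\<Omega> x))" using single by simp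
  also have "\<dots> \<le> card (\<Union>x\<in>F. \<Omega> x) + (\<Sum>x\<in>F. \<Sum>y\<in>F - {x}. card (\<Omega> x \<inter> \<Omega> y))"
    by (rule bonferroni_le[OF F fin])
  also have "(\<Sum>x\<in>F. \<Sum>y\<in>F - {x}. card (\<Omega> x \<inter> \<Omega> y)) = card F * (card F - 1) * fact (card F - 2) ^ r"
    using pair F by simp
  finally show ?thesis using U by simp
qed

section \<open>Probability that random permutations generate a transitive group\<close>

definition transitive_prob :: "nat \<Rightarrow> nat \<Rightarrow> real" where
  "transitive_prob N r = real (transitive_count {1..N} r) / fact N ^ r"

text \<open>The term for \<open>k = 2\<close> is at most \<open>4 / N ^ 2\<close>. Each of the fewer
  than \<open>N / 2\<close> later terms is at most the one for \<open>k = 3\<close>, of order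
  \<open>1 / N ^ 3\<close>, so together they contribute at most \<open>8 / N ^ 2\<close>.\<close>

lemma sum_inverse_choose_le:
  "(\<Sum>k = 2..N div 2. 1 / real (N choose k)) \<le> 12 / real N ^ 2"
proof (cases "N \<ge> 4")
  case True
  then have N: "real N \<ge> 4" by simp
  have c2: "2 * real (N choose 2) = real N * (real N - 1)"
  proof -
    have "2 * (N choose 2) = N * (N - 1)" using times_binomial_minus1_eq[of 2 N] by simp
    then have "real (2 * (N choose 2)) = real (N * (N - 1))" by (simp only:)
    then show ?thesis using True by (simp add: of_nat_diff)
  qed
  have c3: "6 * real (N choose 3) = real N * (real N - 1) * (real N - 2)"
  proof -
    have "6 * (N choose 3) = 2 * (3 * (N choose 3))" by simp
    also have "\<dots> = N * (2 * ((N - 1) choose 2))"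
      using times_binomial_minus1_eq[of 3 N] by simp
    also have "\<dots> = N * ((N - 1) * (N - 2))"
      using times_binomial_minus1_eq[of 2 "N - 1"] by (simp add: numeral_2_eq_2)
    finally have "real (6 * (N choose 3)) = real (N * ((N - 1) * (N - 2)))" by (simp only:)
    then show ?thesis using True by (simp add: of_nat_diff)
  qed
  have pos: "real (N choose 3) > 0" using True by simp
  have "(\<Sum>k = 2..N div 2. 1 / real (N choose k)) =
      1 / real (N choose 2) + (\<Sum>k = 3..N div 2. 1 / real (N choose k))"
  proof -
    have "2 \<le> N div 2" using True by linarith
    then show ?thesis by (simp add: sum.atLeast_Suc_atMost)
  qed
  also have "1 / real (N choose 2) \<le> 4 / real N ^ 2"
  proof -
    have "real N * (real N - 2) \<ge> 0" using N by (intro mult_nonneg_nonneg) auto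
    then have "real N ^ 2 \<le> 4 * real (N choose 2)"
      using c2 by (simp add: algebra_simps power2_eq_square)
    moreover have "real (N choose 2) > 0" using True by simp
    ultimately show ?thesis using N by (simp add: divide_simps)
  qed
  also have "(\<Sum>k = 3..N div 2. 1 / real (N choose k)) \<le> (\<Sum>k = 3..N div 2. 1 / real (N choose 3))"
  proof (rule sum_mono)
    fix k assume k: "k \<in> {3..N div 2}"
    then have "N choose 3 \<le> N choose k" by (intro binomial_mono) auto
    then show "1 / real (N choose k) \<le> 1 / real (N choose 3)"
      using pos by (intro frac_le) auto
  qed
  also have "\<dots> \<le> (real N / 2) * (1 / real (N choose 3))"
  proof -
    have "real (Suc (N div 2) - 3) \<le> real N / 2" by linarith
    then show ?thesis using pos by (simp add: divide_simps)
  qed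
  also have "\<dots> \<le> 8 / real N ^ 2"
  proof -
    \<comment> \<open>This product equals
      \<open>8 * ((N - 1) * (N - 2)) - 3 * N ^ 2\<close>.\<close>
    have "(real N - 4) * (5 * real N - 4) \<ge> 0" using N by (intro mult_nonneg_nonneg) auto
    then have *: "3 * real N ^ 2 \<le> 8 * ((real N - 1) * (real N - 2))"
      by (simp add: algebra_simps power2_eq_square)
    have "real (N choose 3) = real N * (real N - 1) * (real N - 2) / 6" using c3 by simp
    then have "(real N / 2) * (1 / real (N choose 3)) = 3 / ((real N - 1) * (real N - 2))"
      using N by (simp add: divide_simps)
    also have "\<dots> \<le> 8 / real N ^ 2"
      using N * by (simp add: divide_simps mult.commute)
    finally show ?thesis .
  qed
  finally show ?thesis by simp
next
  case False
  \<comment> \<open>For \<open>N < 4\<close> the sum is empty.\<close>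
  then have "N div 2 < 2" by linarith
  then show ?thesis by simp
qed

lemma transitive_prob_eq:
  "transitive_prob N r = 1 - real (card {\<sigma> \<in> labelings {..<r} {1..N}.
     \<not> connected_on {1..N} (action_rel {..<r} {1..N} \<sigma>)}) / fact N ^ r"
proof -
  have "real (card {\<sigma> \<in> labelings {..<r} {1..N}. \<not> connected_on {1..N} (action_rel {..<r} {1..N} \<sigma>)}
      + transitive_count {1..N} r) = fact N ^ r"
    by (subst intransitive_count_eq) auto
  then show ?thesis by (simp add: transitive_prob_def divide_simps)
qed

lemma transitive_prob_le_1: "transitive_prob N r \<le> 1"
  by (simp add: transitive_prob_eq)

lemma transitive_prob_nonneg: "transitive_prob N r \<ge> 0"
  by (simp add: transitive_prob_def)

lemma transitive_prob_1_le:
  assumes "N \<ge> 1"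
  shows "transitive_prob N 1 \<le> 1 / real N"
proof -
  have "real (transitive_count {1..N} 1) \<le> real (fact (N - 1))"
    using transitive_count_1_le[of "{1..N}"] assms by (intro of_nat_mono) auto
  moreover have "(fact N :: real) = real N * fact (N - 1)" using assms by (simp add: fact_reduce)
  ultimately show ?thesis using assms by (simp add: transitive_prob_def divide_simps)
qed

text \<open>After division by \<open>fact N ^ (d + 1)\<close> the \<open>k\<close>-th term of the
  union bound is \<open>1 / (N choose k) ^ d\<close>. All but one of these \<open>d\<close> factors
  are bounded by \<open>1 / N\<close>; the remaining one is summed over \<open>k\<close> with
  \<open>sum_inverse_choose_le\<close>.\<close>

lemma transitive_prob_ge:
  assumes "N \<ge> 2" "d \<ge> 1"
  shows "transitive_prob N (d + 1) \<ge> 1 - 1 / real N ^ d - 12 / real N ^ (d + 1)"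
proof -
  let ?S = "\<lambda>k. 1 / real (N choose k)"
  have N: "real N > 0" using assms by simp
  have split: "1 / real N ^ d = 1 / real N ^ (d - 1) * (1 / real N)"
    using assms(2) by (cases d) auto
  have k: "?S k > 0" "?S k \<le> 1 / real N" "k \<le> N" if "k \<in> {1..N div 2}" for k
  proof -
    have kN: "k \<le> N" using that by auto
    then have "N choose k > 0" by simp
    moreover have "N choose 1 \<le> N choose k" using that by (intro binomial_mono) auto
    ultimately show "?S k > 0" "?S k \<le> 1 / real N" "k \<le> N"
      using N kN by (auto intro!: frac_le)
  qed
  have "real (card {\<sigma> \<in> labelings {..<d + 1} {1..N}.
      \<not> connected_on {1..N} (action_rel {..<d + 1} {1..N} \<sigma>)}) \<le>
      real (\<Sum>k = 1..N div 2. (N choose k) * (fact k * fact (N - k)) ^ (d + 1))"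
    using intransitive_count_le[of "{1..N}" "d + 1"] by (intro of_nat_mono) simp
  then have "1 - transitive_prob N (d + 1) \<le>
      (\<Sum>k = 1..N div 2. real (N choose k) * (fact k * fact (N - k)) ^ (d + 1)) / fact N ^ (d + 1)"
    unfolding transitive_prob_eq by (simp add: divide_right_mono)
  also have "\<dots> = (\<Sum>k = 1..N div 2. ?S k ^ d)"
    unfolding sum_divide_distrib
  proof (rule sum.cong[OF refl])
    fix k assume "k \<in> {1..N div 2}"
    then have kN: "k \<le> N" and c: "real (N choose k) > 0" by auto
    have "(fact N :: real) = fact k * fact (N - k) * real (N choose k)"
      using arg_cong[OF binomial_fact_lemma[OF kN], of real] by simp
    then have "(fact k * fact (N - k) :: real) / fact N = ?S k" by simp
    then have "real (N choose k) * (fact k * fact (N - k)) ^ (d + 1) / fact N ^ (d + 1) =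
        real (N choose k) * ?S k ^ (d + 1)"
      by (metis power_divide times_divide_eq_right)
    then show "real (N choose k) * (fact k * fact (N - k)) ^ (d + 1) / fact N ^ (d + 1) = ?S k ^ d"
      using c by simp
  qed
  also have "\<dots> \<le> (\<Sum>k = 1..N div 2. 1 / real N ^ (d - 1) * ?S k)"
  proof (rule sum_mono)
    fix k assume "k \<in> {1..N div 2}"
    note k = k[OF this]
    have "?S k ^ d = ?S k ^ (d - 1) * ?S k" using assms(2) by (cases d) auto
    also have "\<dots> \<le> (1 / real N) ^ (d - 1) * ?S k"
      using k by (intro mult_right_mono power_mono) auto
    finally show "?S k ^ d \<le> 1 / real N ^ (d - 1) * ?S k" by (simp add: power_one_over)
  qed
  also have "\<dots> = 1 / real N ^ (d - 1) * (?S 1 + (\<Sum>k = 2..N div 2. ?S k))"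
  proof -
    have "1 \<le> N div 2" using assms(1) by linarith
    then have "(\<Sum>k = 1..N div 2. ?S k) = ?S 1 + (\<Sum>k = 2..N div 2. ?S k)"
      using sum.atLeast_Suc_atMost[of 1 "N div 2" ?S] by (simp add: numeral_2_eq_2)
    then show ?thesis by (simp only: sum_distrib_left[symmetric])
  qed
  also have "\<dots> \<le> 1 / real N ^ (d - 1) * (1 / real N + 12 / real N ^ 2)"
    using sum_inverse_choose_le[of N] by (intro mult_left_mono) auto
  also have "\<dots> = 1 / real N ^ d + 12 / real N ^ (d + 1)"
    using assms by (cases d) (auto simp: field_simps power2_eq_square)
  finally show ?thesis by simp
qed

text \<open>After division, single fixed points contribute \<open>1 / N ^ d\<close> and pairs
  contribute \<open>1 / (N * (N - 1)) ^ d\<close>. The latter is of lower order since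
  \<open>1 / (N - 1) ^ d \<le> 1 / (N - 1) \<le> 2 / N\<close>.\<close>

lemma transitive_prob_le:
  assumes "N \<ge> 2" "d \<ge> 1"
  shows "transitive_prob N (d + 1) \<le> 1 - 1 / real N ^ d + 2 / real N ^ (d + 1)"
proof -
  let ?n = "real (card {\<sigma> \<in> labelings {..<d + 1} {1..N}.
      \<not> connected_on {1..N} (action_rel {..<d + 1} {1..N} \<sigma>)})"
  let ?f = "fact (N - 2) :: real"
  have N: "real N \<ge> 2" using assms by simp
  define b where "b = real N - 1"
  have b: "b > 0" using N by (simp add: b_def)
  have f: "?f > 0" by simp
  have f1: "(fact (N - 1) :: real) = b * ?f"
    using assms fact_reduce[of "N - 1", where 'a = real] by (simp add: of_nat_diff numeral_2_eq_2 b_def)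
  have f0: "(fact N :: real) = real N * b * ?f"
    using assms f1 by (simp add: fact_reduce)
  have "real (N * fact (N - 1) ^ (d + 1)) \<le>
      real (card {\<sigma> \<in> labelings {..<d + 1} {1..N}.
        \<not> connected_on {1..N} (action_rel {..<d + 1} {1..N} \<sigma>)} + N * (N - 1) * fact (N - 2) ^ (d + 1))"
    using intransitive_count_ge[of "{1..N}" "d + 1"] assms by (intro of_nat_mono) simp
  then have "real N * fact (N - 1) ^ (d + 1) \<le> ?n + real N * b * ?f ^ (d + 1)"
    using assms by (simp add: of_nat_diff b_def)
  then have "(real N * fact (N - 1) ^ (d + 1)) / fact N ^ (d + 1) \<le>
      (?n + real N * b * ?f ^ (d + 1)) / fact N ^ (d + 1)"
    by (intro divide_right_mono) auto
  then have "(real N * fact (N - 1) ^ (d + 1)) / fact N ^ (d + 1) \<le>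
      ?n / fact N ^ (d + 1) + (real N * b * ?f ^ (d + 1)) / fact N ^ (d + 1)"
    by (simp only: add_divide_distrib)
  also have "(real N * fact (N - 1) ^ (d + 1)) / fact N ^ (d + 1) = 1 / real N ^ d"
    unfolding f0 f1 using N f b by (simp add: power_mult_distrib field_simps)
  also have "(real N * b * ?f ^ (d + 1)) / fact N ^ (d + 1) =
      1 / real N ^ d * (1 / b) ^ d"
    unfolding f0 using N f b by (simp add: power_mult_distrib field_simps)
  also have "(1 / b) ^ d \<le> 2 / real N"
  proof -
    have "(1 / b) ^ d \<le> (1 / b) ^ 1"
      using N assms(2) by (unfold b_def, intro power_decreasing) auto
    also have "\<dots> \<le> 2 / real N" using N by (simp add: b_def field_simps)
    finally show ?thesis .
  qed
  finally have "1 / real N ^ d \<le> ?n / fact N ^ (d + 1) + 1 / real N ^ d * (2 / real N)"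
    by (simp add: mult_left_mono divide_right_mono)
  then show ?thesis unfolding transitive_prob_eq by (simp add: mult.commute)
qed

text \<open>For \<open>N = 1\<close> and for \<open>d = 0\<close> the main term
  \<open>1 - 1 / N ^ d\<close> vanishes, so it suffices that the probability is at most
  \<open>1\<close> or at most \<open>1 / N\<close>, respectively. Otherwise the two preceding bounds
  apply.\<close>

lemma transitive_prob_estimate:
  assumes "N \<ge> 1"
  shows "\<bar>transitive_prob N (d + 1) - 1 + 1 / real N ^ d\<bar> \<le> 12 * (1 / real N ^ (d + 1))"
proof -
  consider "N = 1" | "d = 0" | "N \<ge> 2" "d \<ge> 1" using assms by linarith
  then show ?thesis
  proof cases
    case 1
    then show ?thesis
      using transitive_prob_le_1[of 1 "d + 1"] transitive_prob_nonneg[of 1 "d + 1"] by simp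
  next
    case 2
    moreover have "1 / real N \<le> 12 / real N" by (intro divide_right_mono) auto
    ultimately show ?thesis
      using transitive_prob_1_le[OF assms] transitive_prob_nonneg[of N 1] by simp
  next
    case 3
    have "2 / real N ^ (d + 1) \<le> 12 / real N ^ (d + 1)" by (intro divide_right_mono) auto
    then show ?thesis using transitive_prob_le[OF 3] transitive_prob_ge[OF 3] by (simp add: abs_le_iff)
  qed
qed

section \<open>Decomposition of the wreath product\<close>

abbreviation wreath :: "nat \<Rightarrow> (nat \<Rightarrow> nat) \<Rightarrow> ((nat \<Rightarrow> nat) \<Rightarrow> (nat \<Rightarrow> nat)) set" where
  "wreath k n \<equiv> carrier (iterated_wreath k n)"

lemma wreath_iff:
  "\<pi> \<in> wreath k n \<longleftrightarrow> \<pi> \<in> extensional (tuples k n) \<and> bij_betw \<pi> (tuples k n) (tuples k n) \<and>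
    (\<forall>m\<in>{1..k}. \<forall>x\<in>tuples k n. \<forall>y\<in>tuples k n.
      (\<forall>j\<in>{1..m}. x j = y j) \<longrightarrow> (\<forall>j\<in>{1..m}. \<pi> x j = \<pi> y j))"
  by (simp add: iterated_wreath_def BijGroup_def Bij_def conj_assoc)

lemma wreath_in: "\<pi> \<in> wreath k n \<Longrightarrow> x \<in> tuples k n \<Longrightarrow> \<pi> x \<in> tuples k n"
  using bij_betwE unfolding wreath_iff by blast

lemma wreath_one: "\<one>\<^bsub>iterated_wreath k n\<^esub> = (\<lambda>x\<in>tuples k n. x)"
  by (simp add: iterated_wreath_def BijGroup_def)

lemma wreath_mult:
  assumes "a \<in> wreath k n" "b \<in> wreath k n" "x \<in> tuples k n"
  shows "(a \<otimes>\<^bsub>iterated_wreath k n\<^esub> b) x = a (b x)"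
  using assms by (simp add: iterated_wreath_def BijGroup_def compose_eq)

text \<open>Orbits of the generated group are the components of the Schreier graph: a predicate
  invariant under the generators is invariant under inverses and products, and conversely membership
  in the orbit of a point is an invariant of the graph.\<close>

lemma generates_transitive_iff_connected:
  assumes S: "g ` I \<subseteq> wreath k n"
  shows "generates_transitive k n (g ` I) \<longleftrightarrow>
    connected_on (tuples k n) (action_rel I (tuples k n) g)"
proof -
  let ?W = "iterated_wreath k n" and ?T = "tuples k n"
  interpret W: group ?W by (rule group_iterated_wreath)
  have G: "\<pi> \<in> wreath k n" if "\<pi> \<in> generate ?W (g ` I)" for \<pi>
    using W.generate_incl[OF S] that by blast
  have inv1: "h ((inv\<^bsub>?W\<^esub> h) x) = x" and inv2: "(inv\<^bsub>?W\<^esub> h) (h x) = x"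
    if "h \<in> wreath k n" "x \<in> ?T" for h x
    using wreath_mult[of h k n "inv\<^bsub>?W\<^esub> h" x] wreath_mult[of "inv\<^bsub>?W\<^esub> h" k n h x]
      that W.r_inv[of h] W.l_inv[of h] by (auto simp: wreath_one)
  show ?thesis
  proof
    assume tr: "generates_transitive k n (g ` I)"
    show "connected_on ?T (action_rel I ?T g)"
    proof (rule connected_onI)
      fix P x y
      assume "\<And>a b. (a, b) \<in> action_rel I ?T g \<Longrightarrow> P a = P b"
        and xy: "x \<in> ?T" "y \<in> ?T" and Px: "P x"
      then have P: "P (g i a) = P a" if "i \<in> I" "a \<in> ?T" for i a
        using that unfolding action_rel_def by force
      have inv: "\<forall>a\<in>?T. P (\<pi> a) = P a" if "\<pi> \<in> generate ?W (g ` I)" for \<pi>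
        using that
      proof (induction rule: generate.induct)
        case one
        then show ?case by (simp add: wreath_one)
      next
        case (incl h)
        then show ?case using P by auto
      next
        case (inv h)
        then have h: "h \<in> wreath k n" using S by auto
        obtain i where i: "i \<in> I" "h = g i" using inv by auto
        show ?case
        proof
          fix a assume a: "a \<in> ?T"
          then have "(inv\<^bsub>?W\<^esub> h) a \<in> ?T" using wreath_in[OF W.inv_closed[OF h]] by blast
          then show "P ((inv\<^bsub>?W\<^esub> h) a) = P a" using P[OF i(1)] inv1[OF h a] i(2) by metis
        qed
      next
        case (eng h1 h2)
        then show ?case using wreath_mult[OF G G] wreath_in[OF G] by metis
      qed
      obtain \<pi> where "\<pi> \<in> generate ?W (g ` I)" "\<pi> x = y"
        using tr xy unfolding generates_transitive_iff[OF S] by blast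
      then show "P y" using inv xy(1) Px by metis
    qed
  next
    assume c: "connected_on ?T (action_rel I ?T g)"
    show "generates_transitive k n (g ` I)"
      unfolding generates_transitive_iff[OF S]
    proof (intro ballI)
      fix x y assume xy: "x \<in> ?T" "y \<in> ?T"
      \<comment> \<open>This predicate describes the orbit of \<open>x\<close>. Going forward along
        an edge uses the generator, going back uses its inverse.\<close>
      let ?P = "\<lambda>z. \<exists>\<pi>\<in>generate ?W (g ` I). \<pi> x = z"
      have "?P x = ?P y"
      proof (rule connected_onD[OF c _ xy])
        fix a b assume "(a, b) \<in> action_rel I ?T g"
        then obtain i where i: "i \<in> I" "a \<in> ?T" "b = g i a" by (auto simp: action_rel_def)
        then have gi: "g i \<in> wreath k n" using S by auto
        have "?P b" if \<pi>: "\<pi> \<in> generate ?W (g ` I)" "\<pi> x = a" for \<pi>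
        proof
          show "g i \<otimes>\<^bsub>?W\<^esub> \<pi> \<in> generate ?W (g ` I)"
            using i by (intro generate.eng[OF generate.incl \<pi>(1)]) auto
          show "(g i \<otimes>\<^bsub>?W\<^esub> \<pi>) x = b"
            using wreath_mult[OF gi G[OF \<pi>(1)] xy(1)] \<pi> i by simp
        qed
        moreover have "?P a" if \<pi>: "\<pi> \<in> generate ?W (g ` I)" "\<pi> x = b" for \<pi>
        proof
          show "inv\<^bsub>?W\<^esub> (g i) \<otimes>\<^bsub>?W\<^esub> \<pi> \<in> generate ?W (g ` I)"
            using i by (intro generate.eng[OF generate.inv \<pi>(1)]) auto
          show "(inv\<^bsub>?W\<^esub> (g i) \<otimes>\<^bsub>?W\<^esub> \<pi>) x = a"
            using wreath_mult[OF W.inv_closed[OF gi] G[OF \<pi>(1)] xy(1)] \<pi> i inv2[OF gi] by simp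
        qed
        ultimately show "?P a = ?P b" by blast
      qed
      moreover have "?P x"
        using generate.one[of ?W "g ` I"] xy(1) by (intro bexI) (auto simp: wreath_one)
      ultimately show "?P y" by blast
    qed
  qed
qed

section \<open>Splitting off the last coordinate and the last wreath factor\<close>

definition snoc :: "nat \<Rightarrow> (nat \<Rightarrow> nat) \<times> nat \<Rightarrow> nat \<Rightarrow> nat" where
  "snoc k = (\<lambda>(y, f). y(Suc k := f))"

lemma snoc_eq_iff:
  assumes "y \<in> tuples k n" "y' \<in> tuples k n"
  shows "snoc k (y, f) = snoc k (y', f') \<longleftrightarrow> y = y' \<and> f = f'"
proof
  assume eq: "snoc k (y, f) = snoc k (y', f')"
  have "y j = y' j" for j
    using fun_cong[OF eq, of j] assms by (cases "j = Suc k") (auto simp: snoc_def tuples_def PiE_def extensional_def)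
  moreover have "f = f'" using fun_cong[OF eq, of "Suc k"] by (simp add: snoc_def)
  ultimately show "y = y' \<and> f = f'" by auto
qed simp

lemma bij_betw_snoc: "bij_betw (snoc k) (tuples k n \<times> {1..n (Suc k)}) (tuples (Suc k) n)"
proof -
  have *: "{1..Suc k} = insert (Suc k) {1..k}" by auto
  have "tuples (Suc k) n = snoc k ` (tuples k n \<times> {1..n (Suc k)})"
    unfolding tuples_def * PiE_insert_eq snoc_def by (force simp: image_iff)
  moreover have "inj_on (snoc k) (tuples k n \<times> {1..n (Suc k)})"
    by (auto simp: inj_on_def snoc_eq_iff[of _ k n])
  ultimately show ?thesis by (simp add: bij_betw_def)
qed

lemma snoc_in: "y \<in> tuples k n \<Longrightarrow> f \<in> {1..n (Suc k)} \<Longrightarrow> snoc k (y, f) \<in> tuples (Suc k) n"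
  using bij_betwE[OF bij_betw_snoc[of k n]] by auto

lemma tuples_SucE:
  assumes "z \<in> tuples (Suc k) n"
  obtains y f where "y \<in> tuples k n" "f \<in> {1..n (Suc k)}" "z = snoc k (y, f)"
  using assms bij_betw_imp_surj_on[OF bij_betw_snoc[of k n]] by force

lemma snoc_last [simp]: "snoc k (y, f) (Suc k) = f"
  by (simp add: snoc_def)

lemma snoc_init [simp]: "j \<le> k \<Longrightarrow> snoc k (y, f) j = y j"
  by (simp add: snoc_def)

lemma restrict_snoc: "y \<in> tuples k n \<Longrightarrow> restrict (snoc k (y, f)) {1..k} = y"
  by (auto simp: tuples_def PiE_def extensional_def fun_eq_iff)

text \<open>This realises the semidirect product decomposition on tree automorphisms:
  \<open>\<rho>\<close> acts on the first \<open>k\<close> levels, and \<open>\<sigma> y\<close>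
  says how the children of the vertex \<open>y\<close> are mapped to those of
  \<open>\<rho> y\<close>. The label is attached to the source vertex.\<close>

definition wreath_join ::
    "nat \<Rightarrow> (nat \<Rightarrow> nat) \<Rightarrow> ((nat \<Rightarrow> nat) \<Rightarrow> nat \<Rightarrow> nat) \<times> ((nat \<Rightarrow> nat) \<Rightarrow> nat \<Rightarrow> nat) \<Rightarrow> (nat \<Rightarrow> nat) \<Rightarrow> nat \<Rightarrow> nat" where
  "wreath_join k n = (\<lambda>(\<rho>, \<sigma>). \<lambda>z\<in>tuples (Suc k) n.
     snoc k (\<rho> (restrict z {1..k}), \<sigma> (restrict z {1..k}) (z (Suc k))))"

lemma wreath_join_snoc:
  assumes "y \<in> tuples k n" "f \<in> {1..n (Suc k)}"
  shows "wreath_join k n (\<rho>, \<sigma>) (snoc k (y, f)) = snoc k (\<rho> y, \<sigma> y f)"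
  using assms snoc_in[OF assms] by (simp add: wreath_join_def restrict_snoc[simplified])

lemma wreath_join_in:
  assumes \<rho>: "\<rho> \<in> wreath k n" and \<sigma>: "\<sigma> \<in> labelings (tuples k n) {1..n (Suc k)}"
  shows "wreath_join k n (\<rho>, \<sigma>) \<in> wreath (Suc k) n"
proof -
  let ?T = "tuples k n" and ?F = "{1..n (Suc k)}" and ?T' = "tuples (Suc k) n"
  let ?\<pi> = "wreath_join k n (\<rho>, \<sigma>)"
  note in\<rho> = wreath_in[OF \<rho>] and in\<sigma> = labelings_in[OF \<sigma>]
  have ext: "?\<pi> \<in> extensional ?T'" by (simp add: wreath_join_def)
  have "?\<pi> ` ?T' \<subseteq> ?T'"
    by (auto elim!: tuples_SucE simp: wreath_join_snoc intro!: snoc_in in\<rho> in\<sigma>[simplified])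
  moreover have "inj_on ?\<pi> ?T'"
  proof (rule inj_onI)
    fix z z' assume z: "z \<in> ?T'" and z': "z' \<in> ?T'" and eq: "?\<pi> z = ?\<pi> z'"
    obtain y f where y: "y \<in> ?T" "f \<in> ?F" "z = snoc k (y, f)" using z by (rule tuples_SucE)
    obtain y' f' where y': "y' \<in> ?T" "f' \<in> ?F" "z' = snoc k (y', f')" using z' by (rule tuples_SucE)
    have *: "\<rho> y = \<rho> y'" "\<sigma> y f = \<sigma> y' f'"
      using eq y y' by (simp_all add: wreath_join_snoc snoc_eq_iff[OF in\<rho> in\<rho>])
    then have "y = y'"
      using \<rho> y(1) y'(1) by (auto simp: wreath_iff bij_betw_def dest: inj_onD)
    moreover have "\<sigma> y permutes ?F" using \<sigma> y(1) by auto
    ultimately show "z = z'" using * y y' permutes_inj[of "\<sigma> y" ?F] by (auto dest: injD)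
  qed
  ultimately have bij: "bij_betw ?\<pi> ?T' ?T'"
    using endo_inj_surj[OF finite_tuples] by (simp add: bij_betw_def)
  have "\<forall>j\<in>{1..m}. ?\<pi> z j = ?\<pi> z' j"
    if m: "m \<in> {1..Suc k}" and z: "z \<in> ?T'" and z': "z' \<in> ?T'" and eq: "\<forall>j\<in>{1..m}. z j = z' j" for m z z'
  proof -
    obtain y f where y: "y \<in> ?T" "f \<in> ?F" "z = snoc k (y, f)" using z by (rule tuples_SucE)
    obtain y' f' where y': "y' \<in> ?T" "f' \<in> ?F" "z' = snoc k (y', f')" using z' by (rule tuples_SucE)
    show ?thesis
    proof (cases "m = Suc k")
      case True
      \<comment> \<open>At the last level, agreement in all coordinates is equality; the lower
        levels inherit the condition from \<open>\<rho>\<close>.\<close>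
      have "z = z'" using z z' eq True by (auto simp: tuples_def intro: PiE_ext)
      then show ?thesis by simp
    next
      case False
      then have m: "m \<in> {1..k}" using m by auto
      then have "\<forall>j\<in>{1..m}. y j = y' j" using eq by (auto simp: y(3) y'(3))
      then have "\<forall>j\<in>{1..m}. \<rho> y j = \<rho> y' j"
        using \<rho> m y(1) y'(1) unfolding wreath_iff by blast
      then show ?thesis using m y y' by (simp add: wreath_join_snoc)
    qed
  qed
  then show ?thesis using ext bij unfolding wreath_iff by blast
qed

lemma inj_on_wreath_join:
  assumes ne: "n (Suc k) \<ge> 1"
  shows "inj_on (wreath_join k n) (wreath k n \<times> labelings (tuples k n) {1..n (Suc k)})"
proof (rule inj_onI, clarify)
  let ?T = "tuples k n" and ?F = "{1..n (Suc k)}"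
  fix \<rho> \<sigma> \<rho>' \<sigma>'
  assume \<rho>: "\<rho> \<in> wreath k n" "\<rho>' \<in> wreath k n"
    and \<sigma>: "\<sigma> \<in> labelings ?T ?F" "\<sigma>' \<in> labelings ?T ?F"
    and eq: "wreath_join k n (\<rho>, \<sigma>) = wreath_join k n (\<rho>', \<sigma>')"
  have *: "\<rho> y = \<rho>' y \<and> \<sigma> y f = \<sigma>' y f" if "y \<in> ?T" "f \<in> ?F" for y f
    using fun_cong[OF eq, of "snoc k (y, f)"] that \<rho>
    by (simp add: wreath_join_snoc snoc_eq_iff[of _ k n] wreath_in)
  have "\<rho> = \<rho>'"
  proof (rule extensionalityI)
    show "\<rho> \<in> extensional ?T" "\<rho>' \<in> extensional ?T" using \<rho> by (auto simp: wreath_iff)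
    \<comment> \<open>Reading off \<open>\<rho>\<close> requires a point in the fibre;
      \<open>1\<close> is available because \<open>n (Suc k) \<ge> 1\<close>.\<close>
    show "\<rho> y = \<rho>' y" if "y \<in> ?T" for y using *[OF that, of 1] ne by simp
  qed
  moreover have "\<sigma> = \<sigma>'"
  proof (rule PiE_ext[OF \<sigma>])
    fix y assume y: "y \<in> ?T"
    then have p: "\<sigma> y permutes ?F" "\<sigma>' y permutes ?F" using \<sigma> by auto
    show "\<sigma> y = \<sigma>' y"
    proof
      fix f show "\<sigma> y f = \<sigma>' y f"
        using *[OF y, of f] permutes_not_in[OF p(1), of f] permutes_not_in[OF p(2), of f]
        by (cases "f \<in> ?F") auto
    qed
  qed
  ultimately show "\<rho> = \<rho>' \<and> \<sigma> = \<sigma>'" by simp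
qed

text \<open>The condition for \<open>m = k\<close> says that the first \<open>k\<close> coordinates
  of an image do not depend on the last coordinate of the argument. So \<open>\<rho>\<close> can be
  read off at last coordinate \<open>1\<close>, and \<open>\<sigma>\<close> records the last
  coordinate of the image.\<close>

lemma wreath_join_surj:
  assumes ne: "n (Suc k) \<ge> 1" and \<pi>: "\<pi> \<in> wreath (Suc k) n"
  shows "\<pi> \<in> wreath_join k n ` (wreath k n \<times> labelings (tuples k n) {1..n (Suc k)})"
proof -
  let ?T = "tuples k n" and ?F = "{1..n (Suc k)}" and ?T' = "tuples (Suc k) n"
  define \<rho> where "\<rho> = (\<lambda>y\<in>?T. restrict (\<pi> (snoc k (y, 1))) {1..k})"
  \<comment> \<open>Outside the fibre each label must be the identity, as \<open>permutes\<close>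
    demands.\<close>
  define \<sigma> where "\<sigma> = (\<lambda>y\<in>?T. \<lambda>f. if f \<in> ?F then \<pi> (snoc k (y, f)) (Suc k) else f)"
  have bij: "bij_betw \<pi> ?T' ?T'" and pref: "\<And>m x y. m \<in> {1..Suc k} \<Longrightarrow> x \<in> ?T' \<Longrightarrow> y \<in> ?T' \<Longrightarrow>
      \<forall>j\<in>{1..m}. x j = y j \<Longrightarrow> \<forall>j\<in>{1..m}. \<pi> x j = \<pi> y j"
    using \<pi> unfolding wreath_iff by blast+
  have one: "1 \<in> ?F" using ne by simp
  have split: "\<rho> y \<in> ?T \<and> \<sigma> y f \<in> ?F \<and> \<pi> (snoc k (y, f)) = snoc k (\<rho> y, \<sigma> y f)"
    if y: "y \<in> ?T" "f \<in> ?F" for y f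
  proof -
    have "\<pi> (snoc k (y, f)) \<in> ?T'" using wreath_in[OF \<pi> snoc_in[OF y]] .
    then obtain y' f' where y': "y' \<in> ?T" "f' \<in> ?F" "\<pi> (snoc k (y, f)) = snoc k (y', f')"
      by (rule tuples_SucE)
    have "\<pi> (snoc k (y, f)) j = \<pi> (snoc k (y, 1)) j" if "j \<in> {1..k}" for j
      using pref[of k "snoc k (y, f)" "snoc k (y, 1)"] snoc_in[OF y] snoc_in[OF y(1) one] that by auto
    then have "\<rho> y = restrict (\<pi> (snoc k (y, f))) {1..k}"
      using y by (auto simp: \<rho>_def fun_eq_iff)
    then have "\<rho> y = y'" using y' by (simp only: restrict_snoc)
    moreover have "\<sigma> y f = f'" using y y' by (simp add: \<sigma>_def)
    ultimately show ?thesis using y' by simp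
  qed
  have "\<rho> \<in> wreath k n"
    unfolding wreath_iff
  proof (intro conjI ballI impI)
    show "\<rho> \<in> extensional ?T" by (simp add: \<rho>_def)
    have "\<rho> ` ?T = ?T"
    proof
      show "\<rho> ` ?T \<subseteq> ?T" using split[OF _ one] by blast
      show "?T \<subseteq> \<rho> ` ?T"
      proof
        fix y assume y: "y \<in> ?T"
        then obtain z where z: "z \<in> ?T'" "\<pi> z = snoc k (y, 1)"
          using snoc_in[OF y one] bij by (metis bij_betw_def imageE)
        obtain y' f' where y': "y' \<in> ?T" "f' \<in> ?F" "z = snoc k (y', f')" using z(1) by (rule tuples_SucE)
        have "\<rho> y' = y" using split[OF y'(1,2)] z y y' snoc_eq_iff[of _ k n] by metis
        then show "y \<in> \<rho> ` ?T" using y' by blast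
      qed
    qed
    then show "bij_betw \<rho> ?T ?T"
      using finite_surj_inj[OF finite_tuples, of k n \<rho>] by (simp add: bij_betw_def)
  next
    fix m x y j
    assume m: "m \<in> {1..k}" and xy: "x \<in> ?T" "y \<in> ?T" and eq: "\<forall>j\<in>{1..m}. x j = y j" and j: "j \<in> {1..m}"
    have "\<forall>j\<in>{1..m}. snoc k (x, 1) j = snoc k (y, 1) j" using eq m by auto
    then have "\<pi> (snoc k (x, 1)) j = \<pi> (snoc k (y, 1)) j"
      using pref[of m "snoc k (x, 1)" "snoc k (y, 1)"] snoc_in[OF xy(1) one] snoc_in[OF xy(2) one] m j
      by simp
    then show "\<rho> x j = \<rho> y j" using xy j m by (simp add: \<rho>_def)
  qed
  moreover have "\<sigma> \<in> labelings ?T ?F"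
  proof (rule PiE_I)
    fix y assume y: "y \<in> ?T"
    have "\<sigma> y permutes ?F"
    proof (rule bij_imp_permutes)
      have "inj_on (\<sigma> y) ?F"
      proof (rule inj_onI)
        fix f f' assume f: "f \<in> ?F" "f' \<in> ?F" "\<sigma> y f = \<sigma> y f'"
        then have "\<pi> (snoc k (y, f)) = \<pi> (snoc k (y, f'))" using split[OF y] by metis
        then have "snoc k (y, f) = snoc k (y, f')"
          using bij snoc_in[OF y] f by (auto simp: bij_betw_def dest: inj_onD)
        then show "f = f'" using snoc_eq_iff[OF y y] by blast
      qed
      moreover have "\<sigma> y ` ?F \<subseteq> ?F" using split[OF y] by blast
      ultimately show "bij_betw (\<sigma> y) ?F ?F"
        using endo_inj_surj[of ?F "\<sigma> y"] by (simp add: bij_betw_def)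
    qed (use y in \<open>auto simp: \<sigma>_def\<close>)
    then show "\<sigma> y \<in> {p. p permutes ?F}" by simp
  qed (simp add: \<sigma>_def)
  moreover have "\<pi> = wreath_join k n (\<rho>, \<sigma>)"
  proof (rule extensionalityI[of _ ?T'])
    show "\<pi> \<in> extensional ?T'" using \<pi> by (simp add: wreath_iff)
    show "wreath_join k n (\<rho>, \<sigma>) \<in> extensional ?T'" by (simp add: wreath_join_def)
    fix z assume "z \<in> ?T'"
    then obtain y f where "y \<in> ?T" "f \<in> ?F" "z = snoc k (y, f)" by (rule tuples_SucE)
    then show "\<pi> z = wreath_join k n (\<rho>, \<sigma>) z" using split by (simp add: wreath_join_snoc)
  qed
  ultimately show ?thesis by blast
qed

lemma bij_betw_wreath_join:
  assumes "n (Suc k) \<ge> 1"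
  shows "bij_betw (wreath_join k n) (wreath k n \<times> labelings (tuples k n) {1..n (Suc k)}) (wreath (Suc k) n)"
  unfolding bij_betw_def
proof (intro conjI subset_antisym subsetI)
  show "inj_on (wreath_join k n) (wreath k n \<times> labelings (tuples k n) {1..n (Suc k)})"
    by (rule inj_on_wreath_join[where n = n and k = k, OF assms])
  show "\<pi> \<in> wreath_join k n ` (wreath k n \<times> labelings (tuples k n) {1..n (Suc k)})"
    if "\<pi> \<in> wreath (Suc k) n" for \<pi>
    by (rule wreath_join_surj[where n = n and k = k, OF assms that])
qed (use wreath_join_in in blast)

text \<open>The decomposition is applied to each member, and the resulting labels are uncurried: a
  family of label functions on vertices becomes a single labeling of the edge set
  \<open>I \<times> tuples k n\<close> of the Schreier graph.\<close>

lemma bij_betw_wreath_families: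
  assumes ne: "n (Suc k) \<ge> 1"
  shows "bij_betw (\<lambda>(h, \<tau>). \<lambda>i\<in>I. wreath_join k n (h i, \<lambda>y\<in>tuples k n. \<tau> (i, y)))
    ((\<Pi>\<^sub>E i\<in>I. wreath k n) \<times> labelings (I \<times> tuples k n) {1..n (Suc k)}) (\<Pi>\<^sub>E i\<in>I. wreath (Suc k) n)"
proof -
  let ?T = "tuples k n" and ?F = "{1..n (Suc k)}"
  let ?\<Phi> = "\<lambda>(h, \<tau>). \<lambda>i\<in>I. wreath_join k n (h i, \<lambda>y\<in>?T. \<tau> (i, y))"
  let ?D = "(\<Pi>\<^sub>E i\<in>I. wreath k n) \<times> labelings (I \<times> ?T) ?F"
  let ?B = "wreath k n \<times> labelings ?T ?F"
  note bij = bij_betw_wreath_join[where n = n and k = k, OF ne]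
  have D: "(h i, \<lambda>y\<in>?T. \<tau> (i, y)) \<in> ?B" if "(h, \<tau>) \<in> ?D" "i \<in> I" for h \<tau> i
    using that by (auto simp: PiE_def Pi_def)
  have "inj_on ?\<Phi> ?D"
  proof (rule inj_onI, clarify)
    fix h \<tau> h' \<tau>'
    assume h: "h \<in> (\<Pi>\<^sub>E i\<in>I. wreath k n)" "h' \<in> (\<Pi>\<^sub>E i\<in>I. wreath k n)"
      and \<tau>: "\<tau> \<in> labelings (I \<times> ?T) ?F" "\<tau>' \<in> labelings (I \<times> ?T) ?F"
      and eq: "(\<lambda>i\<in>I. wreath_join k n (h i, \<lambda>y\<in>?T. \<tau> (i, y))) =
        (\<lambda>i\<in>I. wreath_join k n (h' i, \<lambda>y\<in>?T. \<tau>' (i, y)))"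
    have *: "h i = h' i \<and> (\<lambda>y\<in>?T. \<tau> (i, y)) = (\<lambda>y\<in>?T. \<tau>' (i, y))" if i: "i \<in> I" for i
    proof -
      have "wreath_join k n (h i, \<lambda>y\<in>?T. \<tau> (i, y)) = wreath_join k n (h' i, \<lambda>y\<in>?T. \<tau>' (i, y))"
        using fun_cong[OF eq, of i] i by simp
      from inj_onD[OF bij_betw_imp_inj_on[OF bij] this] show ?thesis
        using D[of h \<tau> i] D[of h' \<tau>' i] h \<tau> i by blast
    qed
    have "h = h'" by (rule PiE_ext[OF h]) (use * in blast)
    moreover have "\<tau> = \<tau>'"
    proof (rule PiE_ext[OF \<tau>])
      fix e assume "e \<in> I \<times> ?T"
      then obtain i y where e: "e = (i, y)" "i \<in> I" "y \<in> ?T" by blast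
      then show "\<tau> e = \<tau>' e" using fun_cong[OF conjunct2[OF *[OF e(2)]], of y] by simp
    qed
    ultimately show "h = h' \<and> \<tau> = \<tau>'" by simp
  qed
  moreover have "?\<Phi> ` ?D = (\<Pi>\<^sub>E i\<in>I. wreath (Suc k) n)"
  proof
    show "?\<Phi> ` ?D \<subseteq> (\<Pi>\<^sub>E i\<in>I. wreath (Suc k) n)"
      using D bij_betwE[OF bij] by fastforce
    show "(\<Pi>\<^sub>E i\<in>I. wreath (Suc k) n) \<subseteq> ?\<Phi> ` ?D"
    proof
      fix g assume g: "g \<in> (\<Pi>\<^sub>E i\<in>I. wreath (Suc k) n)"
      define a where "a i = inv_into ?B (wreath_join k n) (g i)" for i
      have gi: "g i \<in> wreath_join k n ` ?B" if "i \<in> I" for i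
        using g that bij_betw_imp_surj_on[OF bij] by auto
      have a: "a i \<in> ?B" "wreath_join k n (a i) = g i" if "i \<in> I" for i
        unfolding a_def using gi[OF that] by (rule inv_into_into, rule f_inv_into_f)
      define h where "h = (\<lambda>i\<in>I. fst (a i))"
      define \<tau> where "\<tau> = (\<lambda>(i, y)\<in>I \<times> ?T. snd (a i) y)"
      have snd: "snd (a i) \<in> labelings ?T ?F" "fst (a i) \<in> wreath k n" if "i \<in> I" for i
        using a(1)[OF that] by (auto simp: mem_Times_iff)
      have h\<tau>: "(h, \<tau>) \<in> ?D"
      proof (rule SigmaI)
        show "h \<in> (\<Pi>\<^sub>E i\<in>I. wreath k n)" unfolding h_def using snd by auto
        show "\<tau> \<in> labelings (I \<times> ?T) ?F"
        proof (rule PiE_I)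
          fix e assume "e \<in> I \<times> ?T"
          then show "\<tau> e \<in> {p. p permutes ?F}" using PiE_mem[OF snd(1)] by (auto simp: \<tau>_def)
        qed (auto simp: \<tau>_def)
      qed
      have "?\<Phi> (h, \<tau>) = g"
      proof (rule extensionalityI[of _ I])
        fix i assume i: "i \<in> I"
        have "(\<lambda>y\<in>?T. \<tau> (i, y)) = snd (a i)"
          using i snd(1)[OF i] by (auto simp: \<tau>_def fun_eq_iff PiE_def extensional_def)
        then show "?\<Phi> (h, \<tau>) i = g i" using a(2)[OF i] i by (simp add: h_def)
      qed (use g in \<open>auto simp: PiE_def\<close>)
      then show "g \<in> ?\<Phi> ` ?D" by (rule rev_image_eqI[OF h\<tau> sym])
    qed
  qed
  ultimately show ?thesis by (simp add: bij_betw_def)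
qed

text \<open>Up to the bijection \<open>snoc k\<close>, the Schreier graph one level further down is
  the cover of the Schreier graph of \<open>h\<close> in which the edge \<open>(i, y)\<close> from
  \<open>y\<close> to \<open>h i y\<close> carries the label \<open>\<tau> (i, y)\<close>.\<close>

lemma connected_wreath_join:
  assumes h: "h \<in> (\<Pi>\<^sub>E i\<in>I. wreath k n)" and \<tau>: "\<tau> \<in> labelings (I \<times> tuples k n) {1..n (Suc k)}"
  shows "connected_on (tuples (Suc k) n) (action_rel I (tuples (Suc k) n)
      (\<lambda>i\<in>I. wreath_join k n (h i, \<lambda>y\<in>tuples k n. \<tau> (i, y)))) \<longleftrightarrow>
    connected_on (tuples k n \<times> {1..n (Suc k)})
      (cover_rel (I \<times> tuples k n) snd (\<lambda>(i, y). h i y) {1..n (Suc k)} \<tau>)"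
proof -
  let ?T = "tuples k n" and ?F = "{1..n (Suc k)}" and ?T' = "tuples (Suc k) n"
  let ?C = "cover_rel (I \<times> ?T) snd (\<lambda>(i, y). h i y) ?F \<tau>"
  let ?g = "\<lambda>i\<in>I. wreath_join k n (h i, \<lambda>y\<in>?T. \<tau> (i, y))"
  have T': "?T' = snoc k ` (?T \<times> ?F)" using bij_betw_imp_surj_on[OF bij_betw_snoc] by metis
  have "I \<times> ?T' = (\<lambda>((i, y), f). (i, snoc k (y, f))) ` ((I \<times> ?T) \<times> ?F)"
    unfolding T' by (auto simp: image_iff simp del: atLeastAtMost_iff) blast
  then have "action_rel I ?T' ?g = (\<lambda>(i, x). (x, ?g i x)) ` (\<lambda>((i, y), f). (i, snoc k (y, f))) ` ((I \<times> ?T) \<times> ?F)"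
    by (simp add: action_rel_def)
  also have "\<dots> = map_prod (snoc k) (snoc k) ` ?C"
    unfolding cover_rel_def image_image
    by (rule image_cong) (auto simp: wreath_join_snoc)
  finally have A: "action_rel I ?T' ?g = map_prod (snoc k) (snoc k) ` ?C" .
  have "h i y \<in> ?T" if "i \<in> I" "y \<in> ?T" for i y
    by (rule wreath_in[where \<pi> = "h i"]) (use h that in auto)
  then have "?C \<subseteq> (?T \<times> ?F) \<times> (?T \<times> ?F)"
    using labelings_in[OF \<tau>] by (fastforce simp: cover_rel_def)
  then show ?thesis
    unfolding A unfolding T' by (rule connected_on_image[OF bij_betw_imp_inj_on[OF bij_betw_snoc]])
qed

text \<open>Invariants of the base lift along the projection \<open>fst\<close>; the point
  \<open>f\<close> provides a lift of every vertex.\<close>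

lemma connected_cover_imp_base:
  assumes c: "connected_on (V \<times> F) (cover_rel E s t F \<sigma>)" and f: "f \<in> F"
  shows "connected_on V ((\<lambda>e. (s e, t e)) ` E)"
proof (rule connected_onI)
  fix P x y
  assume P: "\<And>x y. (x, y) \<in> (\<lambda>e. (s e, t e)) ` E \<Longrightarrow> P x = P y" and xy: "x \<in> V" "y \<in> V" "P x"
  have PE: "P (s e) = P (t e)" if "e \<in> E" for e using that by (intro P) (rule imageI)
  have "(P \<circ> fst) (x, f) = (P \<circ> fst) (y, f)"
    by (rule connected_onD[OF c]) (use PE xy f in \<open>auto simp: cover_rel_def\<close>)
  then show "P y" using xy by simp
qed

lemma tuples_nonempty:
  assumes "\<And>i. i \<in> {1..k} \<Longrightarrow> n i \<ge> 1"
  shows "tuples k n \<noteq> {}"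
  using assms by (auto simp: tuples_def PiE_eq_empty_iff Suc_le_eq)

lemma card_tuples: "card (tuples k n) = (\<Prod>i = 1..k. n i)"
  by (simp add: tuples_def card_PiE)

section \<open>Recursion over the levels for transitive families and their probability\<close>

definition transitive_families :: "'i set \<Rightarrow> nat \<Rightarrow> (nat \<Rightarrow> nat) \<Rightarrow> ('i \<Rightarrow> (nat \<Rightarrow> nat) \<Rightarrow> nat \<Rightarrow> nat) set" where
  "transitive_families I k n =
    {g \<in> (\<Pi>\<^sub>E i\<in>I. wreath k n). connected_on (tuples k n) (action_rel I (tuples k n) g)}"

text \<open>By \<open>card_connected_covers\<close>, every transitive family on \<open>k\<close>
  levels has the same number of extensions, whichever Schreier graph it defines. This is why the
  probability becomes a product.\<close>

lemma card_transitive_families_Suc: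
  assumes "finite I" "\<And>i. i \<in> {1..Suc k} \<Longrightarrow> n i \<ge> 1" "I \<noteq> {}"
  defines "M \<equiv> \<Prod>i = 1..k. n i"
  shows "card (transitive_families I (Suc k) n) = card (transitive_families I k n) *
    (fact (n (Suc k)) ^ (M - 1) * transitive_count {1..n (Suc k)} ((card I - 1) * M + 1))"
proof -
  let ?T = "tuples k n" and ?F = "{1..n (Suc k)}" and ?T' = "tuples (Suc k) n"
  let ?cov = "\<lambda>h \<tau>. connected_on (?T \<times> ?F) (cover_rel (I \<times> ?T) snd (\<lambda>(i, y). h i y) ?F \<tau>)"
  have ne: "n (Suc k) \<ge> 1" and M: "M \<ge> 1" using assms(2) by (auto simp: M_def Suc_le_eq)
  have T: "?T \<noteq> {}" "finite ?T" "card ?T = M"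
    using assms(2) by (auto simp: M_def card_tuples finite_tuples intro!: tuples_nonempty)
  have base: "(\<lambda>e. (snd e, (\<lambda>(i, y). h i y) e)) ` (I \<times> ?T) = action_rel I ?T h"
    for h :: "'a \<Rightarrow> (nat \<Rightarrow> nat) \<Rightarrow> nat \<Rightarrow> nat"
    unfolding action_rel_def by (rule image_cong) auto
  have covers: "card {\<tau> \<in> labelings (I \<times> ?T) ?F. ?cov h \<tau>} =
      fact (n (Suc k)) ^ (M - 1) * transitive_count ?F ((card I - 1) * M + 1)"
    if h: "h \<in> transitive_families I k n" for h
  proof -
    have hT: "h i y \<in> ?T" if "i \<in> I" "y \<in> ?T" for i y
      by (rule wreath_in[where \<pi> = "h i"]) (use h that in \<open>auto simp: transitive_families_def\<close>)
    have "card {\<tau> \<in> labelings (I \<times> ?T) ?F. ?cov h \<tau>} =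
      fact (card ?F) ^ (card ?T - 1) * transitive_count ?F (card (I \<times> ?T) + 1 - card ?T)"
    proof (rule conjunct2[OF card_connected_covers])
      show "connected_on ?T ((\<lambda>e. (snd e, (\<lambda>(i, y). h i y) e)) ` (I \<times> ?T))"
        unfolding base using h by (simp add: transitive_families_def)
    qed (use T assms(1) hT in auto)
    \<comment> \<open>Of the \<open>card I * M\<close> edges, the \<open>M - 1\<close> edges of a
      spanning tree are contracted and the others become loops.\<close>
    moreover have "card (I \<times> ?T) + 1 - card ?T = (card I - 1) * M + 1"
      using assms(1,3) T(3) M by (cases "card I") (auto simp: card_cartesian_product)
    ultimately show ?thesis using T(3) by simp
  qed
  let ?\<Phi> = "\<lambda>(h, \<tau>). \<lambda>i\<in>I. wreath_join k n (h i, \<lambda>y\<in>?T. \<tau> (i, y))"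
  let ?S = "SIGMA h:transitive_families I k n. {\<tau> \<in> labelings (I \<times> ?T) ?F. ?cov h \<tau>}"
  note bij = bij_betw_wreath_families[where n = n and k = k and I = I, OF ne]
  have "bij_betw ?\<Phi> {p \<in> (\<Pi>\<^sub>E i\<in>I. wreath k n) \<times> labelings (I \<times> ?T) ?F. case p of (h, \<tau>) \<Rightarrow> ?cov h \<tau>}
    {g \<in> (\<Pi>\<^sub>E i\<in>I. wreath (Suc k) n). connected_on ?T' (action_rel I ?T' g)}"
  proof (rule bij_betw_Collect[OF bij])
    fix p assume "p \<in> (\<Pi>\<^sub>E i\<in>I. wreath k n) \<times> labelings (I \<times> ?T) ?F"
    then obtain h \<tau> where p: "p = (h, \<tau>)"
      and "h \<in> (\<Pi>\<^sub>E i\<in>I. wreath k n)" "\<tau> \<in> labelings (I \<times> ?T) ?F" by (rule SigmaE)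
    then show "connected_on ?T' (action_rel I ?T' (?\<Phi> p)) \<longleftrightarrow> (case p of (h, \<tau>) \<Rightarrow> ?cov h \<tau>)"
      unfolding p prod.case by (intro connected_wreath_join)
  qed
  also have "{p \<in> (\<Pi>\<^sub>E i\<in>I. wreath k n) \<times> labelings (I \<times> ?T) ?F. case p of (h, \<tau>) \<Rightarrow> ?cov h \<tau>} = ?S"
  proof -
    \<comment> \<open>A connected cover has a connected base, so restricting \<open>h\<close> to
      transitive families loses nothing.\<close>
    have "connected_on ?T (action_rel I ?T h)" if "?cov h \<tau>" for h \<tau>
      using connected_cover_imp_base[OF that, of 1] ne unfolding base by simp
    then show ?thesis by (auto simp: transitive_families_def)
  qed
  finally have "card (transitive_families I (Suc k) n) = card ?S"
    by (simp add: bij_betw_same_card transitive_families_def)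
  also have "finite (transitive_families I k n)"
    unfolding transitive_families_def
    using finite_PiE[of I "\<lambda>_. wreath k n"] assms(1) finite_iterated_wreath by auto
  then have "card ?S = (\<Sum>h\<in>transitive_families I k n. card {\<tau> \<in> labelings (I \<times> ?T) ?F. ?cov h \<tau>})"
    using finite_labelings[of "I \<times> ?T" ?F] assms(1) T(2) by (intro card_SigmaI) auto
  also have "\<dots> = card (transitive_families I k n) *
    (fact (n (Suc k)) ^ (M - 1) * transitive_count ?F ((card I - 1) * M + 1))"
    using covers by simp
  finally show ?thesis .
qed

lemma card_wreath_Suc:
  assumes "n (Suc k) \<ge> 1"
  shows "card (wreath (Suc k) n) = card (wreath k n) * fact (n (Suc k)) ^ (\<Prod>i = 1..k. n i)"
  using bij_betw_same_card[OF bij_betw_wreath_join[where n = n and k = k, OF assms]]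
  by (simp add: card_cartesian_product card_labelings finite_tuples card_tuples)

lemma wreath_nonempty: "wreath k n \<noteq> {}"
  using group.is_monoid[OF group_iterated_wreath] monoid.one_closed by blast

lemma prob_transitive_eq:
  "prob_transitive l k n = real (card (transitive_families {..<l} k n)) / real (card (wreath k n)) ^ l"
proof -
  let ?W = "wreath k n"
  \<comment> \<open>The default value of \<open>Pi_pmf\<close> is the value of extensional functions
    outside their domain, so the product distribution is uniform on the families counted
    before.\<close>
  have dflt: "PiE_dflt {..<l} undefined (\<lambda>_. ?W) = (\<Pi>\<^sub>E i\<in>{..<l}. ?W)"
    by (auto simp: PiE_dflt_def PiE_def extensional_def)
  have fin: "finite (\<Pi>\<^sub>E i\<in>{..<l}. ?W)" by (intro finite_PiE finite_iterated_wreath) simp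
  have "Pi_pmf {..<l} undefined (\<lambda>_. pmf_of_set ?W) = pmf_of_set (\<Pi>\<^sub>E i\<in>{..<l}. ?W)"
    unfolding dflt[symmetric] using finite_iterated_wreath wreath_nonempty by (intro Pi_pmf_of_set) auto
  moreover have "(\<Pi>\<^sub>E i\<in>{..<l}. ?W) \<inter> {g. generates_transitive k n (g ` {..<l})} =
    transitive_families {..<l} k n"
  proof -
    have "generates_transitive k n (g ` {..<l}) \<longleftrightarrow> connected_on (tuples k n) (action_rel {..<l} (tuples k n) g)"
      if "g \<in> (\<Pi>\<^sub>E i\<in>{..<l}. ?W)" for g
      by (rule generates_transitive_iff_connected) (use that in auto)
    then show ?thesis by (auto simp: transitive_families_def)
  qed
  moreover have "(\<Pi>\<^sub>E i\<in>{..<l}. ?W) \<noteq> {}" using wreath_nonempty by (simp add: PiE_eq_empty_iff)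
  ultimately show ?thesis
    unfolding prob_transitive_def by (simp add: measure_pmf_of_set fin card_PiE)
qed

text \<open>There is only the empty tuple, so every family is transitive; this starts the
  recursion.\<close>

lemma prob_transitive_0: "prob_transitive l 0 n = 1"
proof -
  have T: "tuples 0 n = {\<lambda>_. undefined}" by (simp add: tuples_def)
  have "connected_on (tuples 0 n) R" for R by (auto simp: T connected_on_def)
  then have "transitive_families {..<l} 0 n = (\<Pi>\<^sub>E i\<in>{..<l}. wreath 0 n)"
    by (simp add: transitive_families_def)
  moreover have "card (wreath 0 n) > 0"
    using finite_iterated_wreath wreath_nonempty by (simp add: card_gt_0_iff)
  ultimately show ?thesis by (simp add: prob_transitive_eq card_PiE)
qed

lemma prob_transitive_Suc:
  assumes "l \<ge> 1" and n: "\<And>i. i \<in> {1..Suc k} \<Longrightarrow> n i \<ge> 1"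
  shows "prob_transitive l (Suc k) n =
    prob_transitive l k n * transitive_prob (n (Suc k)) ((l - 1) * (\<Prod>i = 1..k. n i) + 1)"
proof -
  define M where "M = (\<Prod>i = 1..k. n i)"
  let ?f = "fact (n (Suc k)) :: real"
  have M: "M \<ge> 1" using n by (auto simp: M_def Suc_le_eq)
  have "card (transitive_families {..<l} (Suc k) n) = card (transitive_families {..<l} k n) *
    (fact (n (Suc k)) ^ (M - 1) * transitive_count {1..n (Suc k)} ((l - 1) * M + 1))"
    using card_transitive_families_Suc[of "{..<l}" k n] assms by (simp add: M_def lessThan_empty_iff)
  moreover have "card (wreath (Suc k) n) = card (wreath k n) * fact (n (Suc k)) ^ M"
    unfolding M_def using n by (intro card_wreath_Suc) auto
  moreover have "?f ^ (M * l) = ?f ^ (M - 1) * ?f ^ ((l - 1) * M + 1)"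
  proof -
    \<comment> \<open>Tree edges plus remaining loops: the tree labels are free and cancel, while
      the loop labels produce the new factor.\<close>
    have "M * l = (M - 1) + ((l - 1) * M + 1)" using M assms(1) by (cases l) auto
    then show ?thesis by (simp only: power_add)
  qed
  ultimately show ?thesis
    unfolding prob_transitive_eq transitive_prob_def M_def[symmetric]
    by (simp add: power_mult_distrib power_mult[symmetric])
qed

lemma prob_transitive_eq_prod:
  assumes "l \<ge> 1" "\<And>i. i \<in> {1..k} \<Longrightarrow> n i \<ge> 1"
  shows "prob_transitive l k n =
    (\<Prod>i = 1..k. transitive_prob (n i) ((l - 1) * (\<Prod>j = 1..i-1. n j) + 1))"
  using assms(2)
proof (induction k)
  case 0
  then show ?case by (simp add: prob_transitive_0)
next
  case (Suc k)
  then show ?case using prob_transitive_Suc[OF assms(1), of k n] by simp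
qed

text \<open>The O-terms are read uniformly: the constant and the error function of \<open>N\<close>
  and \<open>d\<close> are chosen before \<open>l\<close>, \<open>k\<close> and
  \<open>n\<close>.\<close>

theorem theorem4p18:
  shows "\<exists>(C::real) (\<epsilon>::nat \<Rightarrow> nat \<Rightarrow> real).
    (\<forall>N d. N \<ge> 1 \<longrightarrow> \<bar>\<epsilon> N d\<bar> \<le> C * (1 / real N ^ (d + 1))) \<and>
    (\<forall>(l::nat) (k::nat) (n::nat \<Rightarrow> nat). l \<ge> 1 \<longrightarrow> k \<ge> 1 \<longrightarrow> (\<forall>i\<in>{1..k}. n i \<ge> 1) \<longrightarrow>
       prob_transitive l k n =
         (1 - 1 / real (n 1) ^ (l - 1) + \<epsilon> (n 1) (l - 1)) *
         (\<Prod>i=2..k. (1 - 1 / real (n i) ^ ((l - 1) * (\<Prod>j=1..i-1. n j))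
            + \<epsilon> (n i) ((l - 1) * (\<Prod>j=1..i-1. n j)))))"
proof (intro exI conjI allI impI)
  \<comment> \<open>The error is the exact deviation of the probability for \<open>d + 1\<close>
    permutations, so each factor in the product equals \<open>transitive_prob\<close> identically;
    only its size needs an estimate.\<close>
  let ?\<epsilon> = "\<lambda>N d. transitive_prob N (d + 1) - 1 + 1 / real N ^ d"
  fix N d :: nat assume "N \<ge> 1"
  then show "\<bar>?\<epsilon> N d\<bar> \<le> 12 * (1 / real N ^ (d + 1))" by (rule transitive_prob_estimate)
next
  let ?\<epsilon> = "\<lambda>N d. transitive_prob N (d + 1) - 1 + 1 / real N ^ d"
  fix l k :: nat and n :: "nat \<Rightarrow> nat"
  assume l: "l \<ge> 1" and k: "k \<ge> 1" and n: "\<forall>i\<in>{1..k}. n i \<ge> 1"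
  have "prob_transitive l k n =
      (\<Prod>i = 1..k. transitive_prob (n i) ((l - 1) * (\<Prod>j = 1..i-1. n j) + 1))"
    by (rule prob_transitive_eq_prod) (use l n in auto)
  \<comment> \<open>For \<open>i = 1\<close> the inner product is empty, which gives the exponent
    \<open>l - 1\<close>.\<close>
  also have "\<dots> = transitive_prob (n 1) ((l - 1) + 1) *
      (\<Prod>i = 2..k. transitive_prob (n i) ((l - 1) * (\<Prod>j = 1..i-1. n j) + 1))"
    using k by (simp add: prod.atLeast_Suc_atMost numeral_2_eq_2)
  finally show "prob_transitive l k n =
      (1 - 1 / real (n 1) ^ (l - 1) + ?\<epsilon> (n 1) (l - 1)) *
      (\<Prod>i=2..k. (1 - 1 / real (n i) ^ ((l - 1) * (\<Prod>j=1..i-1. n j))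
        + ?\<epsilon> (n i) ((l - 1) * (\<Prod>j=1..i-1. n j))))"
    by simp
qed

end
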